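(* Let $X$ be a centered non-degenerate self-decomposable random vector in $\mathbb{R}^d$ ($d\ge1$) without Gaussian component, with law $\mu_X$ and Lévy measure $\nu$, such that $\mathbb{E}\|X\|^2<+\infty$, and such that the functions $k_x$ of the polar decomposition of $\nu$ (see context) satisfy $\sup_{x\in S^{d-1}}\sup_{r\in(a,b)}k_x(r)<+\infty$ for all $0<a<b<+\infty$. Let $Y$ be a centered non-degenerate random vector in $\mathbb{R}^d$ with law $\mu_Y$, such that $\mathbb{E}\|Y\|^2<+\infty$, and for which a Stein kernel with respect to $X$ exists. Then $$d_{W_2}(\mu_X,\mu_Y)\le\frac d2\left(\int_{\mathbb{R}^d}\|u\|^2\nu(du)\right)^{1/2}S(\mu_Y||\mu_X).$$
   Context: $\|\cdot\|$ and $\langle\cdot;\cdot\rangle$ are the Euclidean norm and inner product on $\mathbb{R}^d$; $S^{d-1}$ is the unit sphere and $D$ the closed unit ball. A Lévy measure is a positive Borel measure $\nu$ on $\mathbb{R}^d$ with $\nu(\{0\})=0$ and $\int(1\wedge\|u\|^2)\nu(du)<\infty$. $X\sim ID(b,A,\nu)$ means its characteristic function is $\exp\big(i\langle b;\xi\rangle-\frac12\langle\xi;A\xi\rangle+\int(e^{i\langle\xi;u\rangle}-1-i\langle\xi;u\rangle\mathbf{1}_D(u))\nu(du)\big)$; "without Gaussian component" means $A=0$. Non-degenerate means that the support of the law is not contained in a $(d-1)$-dimensional subspace of $\mathbb{R}^d$. A random vector with characteristic function $\varphi$ is self-decomposable if for every $\gamma\in(0,1)$ there is a probability measure on $\mathbb{R}^d$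 with characteristic function $\xi\mapsto\varphi(\xi)/\varphi(\gamma\xi)$. Self-decomposable laws are infinitely divisible. Polar decomposition: the Lévy measure of a self-decomposable law satisfies, for Borel $B\subset\mathbb{R}^d\setminus\{0\}$, $\nu(B)=\int_{S^{d-1}}\lambda(dx)\int_0^{+\infty}\mathbf{1}_B(rx)k_x(r)\frac{dr}{r}$, with $\lambda$ a finite positive measure on $S^{d-1}$ and $k_x(r)\ge0$ measurable in $x$ and non-increasing in $r>0$. One takes $\nu\neq0$ and the normalization $\lambda(S^{d-1})=1$, $\int_0^\infty(r^2\wedge1)k_x(r)dr/r$ finite and independent of $x$, and $k_x(\cdot)$ right-continuous. The supremum over $x\in S^{d-1}$ is a $\lambda$-essential supremum. Stein kernel and discrepancy: a Stein kernel of $Y$ with respect to $X$ is a measurable function $\tau_Y:\mathbb{R}^d\to\mathbb{R}^d$ such that $$\int\langle y;f(y)\rangle\mu_Y(dy)=\int\left(\int\langle f(y+u)-f(y);\tau_Y(y+u)-\tau_Y(y)\rangle\nu(du)\right)\mu_Y(dy)$$ for all $\mathbb{R}^d$-valued test functions $f$ for which both sides are well defined (i.e. the integrals converge absolutely). The Stein discrepancy is $$S(\mu_Y||\mu_X)=\inf\left(\int\int\|\tau_Y(y+u)-\tau_Y(y)-u\|^2\nu(du)\mu_Y(dy)\right)^{1/2},$$ the infimum being over all Stein kernels of $Y$ with respect to $X$ (and $+\infty$ if none exists). Smooth Wasserstein distance: $M_0(h)=\sup_x|h(x)|$, and for $\ell\ge1$, $M_\ell(h)=\sup_x\|\mathbf{D}^\ell(h)(x)\|_{op}$,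 where $\mathbf{D}^\ell(h)(x)$ is the $\ell$-th derivative viewed as an $\ell$-multilinear form and $\|F\|_{op}=\sup\{|F(v_1,\dots,v_\ell)|:\|v_j\|=1\}$. $\mathcal{H}_r$ is the set of bounded continuous real functions on $\mathbb{R}^d$, $r$ times continuously differentiable, with $\max_{0\le\ell\le r}M_\ell(h)\le1$, and $d_{W_r}(\mu_X,\mu_Y)=\sup_{h\in\mathcal{H}_r}|\mathbb{E}h(X)-\mathbb{E}h(Y)|$. *)

theory Defs
  imports "HOL-Probability.Probability"
begin

text \<open>Random vectors enter only through their laws, which are Borel probability measures on a
  Euclidean space \<^typ>\<open>'a\<close>; the dimension $d \ge 1$ is \<open>DIM('a)\<close>.\<close>

definition borel_prob :: "'a::euclidean_space measure \<Rightarrow> bool" where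
  "borel_prob M \<longleftrightarrow> prob_space M \<and> sets M = sets borel"

definition centered :: "'a::euclidean_space measure \<Rightarrow> bool" where
  "centered M \<longleftrightarrow> integrable M (\<lambda>x. x) \<and> (LINT x|M. x) = 0"

definition finite_second_moment :: "'a::euclidean_space measure \<Rightarrow> bool" where
  "finite_second_moment M \<longleftrightarrow> integrable M (\<lambda>x. (norm x)\<^sup>2)"

definition measure_support :: "'a::euclidean_space measure \<Rightarrow> 'a set" where
  "measure_support M = {x. \<forall>U. open U \<and> x \<in> U \<longrightarrow> emeasure M U > 0}"

definition nondegenerate :: "'a::euclidean_space measure \<Rightarrow> bool" where
  "nondegenerate M \<longleftrightarrow>
     \<not> (\<exists>V. subspace V \<and> dim V = DIM('a) - 1 \<and> measure_support M \<subseteq> V)"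

definition charfun :: "'a::euclidean_space measure \<Rightarrow> 'a \<Rightarrow> complex" where
  "charfun M \<xi> = (LINT x|M. exp (\<i> * of_real (\<xi> \<bullet> x)))"

text \<open>The first conjunct only says that the quotient makes sense; without it, HOL's convention
  $z / 0 = 0$ would give the second one a meaning at zeros of the denominator.\<close>

definition self_decomposable :: "'a::euclidean_space measure \<Rightarrow> bool" where
  "self_decomposable M \<longleftrightarrow>
     (\<forall>\<gamma>::real. 0 < \<gamma> \<and> \<gamma> < 1 \<longrightarrow>
        (\<exists>R. borel_prob R \<and>
           (\<forall>\<xi>. charfun M (\<gamma> *\<^sub>R \<xi>) \<noteq> 0 \<and>
                charfun R \<xi> = charfun M \<xi> / charfun M (\<gamma> *\<^sub>R \<xi>))))"

definition levy_measure :: "'a::euclidean_space measure \<Rightarrow> bool" where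
  "levy_measure \<nu> \<longleftrightarrow> sets \<nu> = sets borel \<and> emeasure \<nu> {0} = 0 \<and>
     (\<integral>\<^sup>+u. ennreal (min 1 ((norm u)\<^sup>2)) \<partial>\<nu>) < \<infinity>"

text \<open>The matrix $A$ of a triplet is represented by a linear map.\<close>

definition infinitely_divisible_law ::
  "'a::euclidean_space measure \<Rightarrow> 'a \<Rightarrow> ('a \<Rightarrow> 'a) \<Rightarrow> 'a measure \<Rightarrow> bool" where
  "infinitely_divisible_law M b A \<nu> \<longleftrightarrow>
     borel_prob M \<and> levy_measure \<nu> \<and>
     linear A \<and> (\<forall>x y. A x \<bullet> y = x \<bullet> A y) \<and> (\<forall>x. 0 \<le> x \<bullet> A x) \<and>
     (\<forall>\<xi>. charfun M \<xi> =
        exp (\<i> * of_real (b \<bullet> \<xi>) - of_real (\<xi> \<bullet> A \<xi>) / 2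
             + (LINT u|\<nu>. exp (\<i> * of_real (\<xi> \<bullet> u)) - 1
                         - \<i> * of_real ((\<xi> \<bullet> u) * indicator (cball 0 1) u))))"

text \<open>\<open>\<sigma>\<close> is the spherical part, a measure on the Borel sets of the unit sphere, and
  \<open>k x\<close> is the radial function in direction \<open>x\<close>; only its values on positive reals matter.\<close>

definition polar_decomposition ::
  "'a::euclidean_space measure \<Rightarrow> 'a measure \<Rightarrow> ('a \<Rightarrow> real \<Rightarrow> real) \<Rightarrow> bool" where
  "polar_decomposition \<nu> \<sigma> k \<longleftrightarrow>
     emeasure \<nu> UNIV \<noteq> 0 \<and>
     sets \<sigma> = sets (restrict_space borel (sphere 0 1)) \<and> emeasure \<sigma> (sphere 0 1) = 1 \<and>
     (\<forall>r>0. (\<lambda>x. k x r) \<in> borel_measurable \<sigma>) \<and>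
     (\<forall>x\<in>sphere 0 1. \<forall>r>0. 0 \<le> k x r) \<and>
     (\<forall>x\<in>sphere 0 1. \<forall>r s. 0 < r \<and> r \<le> s \<longrightarrow> k x s \<le> k x r) \<and>
     (\<forall>x\<in>sphere 0 1. \<forall>r>0. continuous (at_right r) (k x)) \<and>
     (\<exists>c::real. \<forall>x\<in>sphere 0 1.
        (\<integral>\<^sup>+r\<in>{0<..}. ennreal (min (r\<^sup>2) 1 * k x r / r) \<partial>lborel) = ennreal c) \<and>
     (\<forall>B\<in>sets borel. B \<subseteq> - {0} \<longrightarrow>
        emeasure \<nu> B =
          (\<integral>\<^sup>+x. (\<integral>\<^sup>+r\<in>{0<..}. indicator B (r *\<^sub>R x) * ennreal (k x r / r) \<partial>lborel) \<partial>\<sigma>))"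

text \<open>Stein kernels of a law \<open>N\<close> with respect to a law whose Levy measure is \<open>\<nu>\<close> (the only
  datum of that law on which the notion depends). The test functions are all Borel functions for
  which both sides of the identity converge absolutely.\<close>

definition stein_kernel ::
  "'a::euclidean_space measure \<Rightarrow> 'a measure \<Rightarrow> ('a \<Rightarrow> 'a) \<Rightarrow> bool" where
  "stein_kernel \<nu> N \<tau> \<longleftrightarrow>
     \<tau> \<in> borel_measurable borel \<and>
     (\<forall>f\<in>borel_measurable borel.
        integrable N (\<lambda>y. y \<bullet> f y) \<and>
        (\<integral>\<^sup>+y. (\<integral>\<^sup>+u. ennreal \<bar>(f (y + u) - f y) \<bullet> (\<tau> (y + u) - \<tau> y)\<bar> \<partial>\<nu>) \<partial>N) < \<infinity> \<longrightarrow>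
        (LINT y|N. y \<bullet> f y) =
          (LINT y|N. (LINT u|\<nu>. (f (y + u) - f y) \<bullet> (\<tau> (y + u) - \<tau> y))))"

definition ennreal_sqrt :: "ennreal \<Rightarrow> ennreal" where
  "ennreal_sqrt x = (if x = \<infinity> then \<infinity> else ennreal (sqrt (enn2real x)))"

definition stein_discrepancy ::
  "'a::euclidean_space measure \<Rightarrow> 'a measure \<Rightarrow> ennreal" where
  "stein_discrepancy \<nu> N =
     (INF \<tau>\<in>{\<tau>. stein_kernel \<nu> N \<tau>}.
        ennreal_sqrt
          (\<integral>\<^sup>+y. (\<integral>\<^sup>+u. ennreal ((norm (\<tau> (y + u) - \<tau> y - u))\<^sup>2) \<partial>\<nu>) \<partial>N))"

text \<open>The \<open>l\<close>-th derivative of \<open>h\<close> at \<open>x\<close> as an \<open>l\<close>-linear form: \<open>iter_deriv h [v\<^sub>1, \<dots>, v\<^sub>l] x\<close>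
  is its value at \<open>(v\<^sub>1, \<dots>, v\<^sub>l)\<close>, obtained by differentiating along each \<open>v\<^sub>j\<close> in turn. In finite
  dimension, the \<open>l\<close>-th derivative is differentiable or continuous iff all these
  evaluations are.\<close>

fun iter_deriv :: "('a::euclidean_space \<Rightarrow> real) \<Rightarrow> 'a list \<Rightarrow> 'a \<Rightarrow> real" where
  "iter_deriv h [] = h"
| "iter_deriv h (v # vs) = (\<lambda>x. frechet_derivative (iter_deriv h vs) (at x) v)"

definition times_cont_differentiable :: "nat \<Rightarrow> ('a::euclidean_space \<Rightarrow> real) \<Rightarrow> bool" where
  "times_cont_differentiable r h \<longleftrightarrow>
     (\<forall>vs. length vs < r \<longrightarrow> (\<forall>x. iter_deriv h vs differentiable (at x))) \<and>
     (\<forall>vs. length vs \<le> r \<longrightarrow> continuous_on UNIV (iter_deriv h vs))"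

definition deriv_bound :: "nat \<Rightarrow> ('a::euclidean_space \<Rightarrow> real) \<Rightarrow> ennreal" where
  "deriv_bound l h =
     (SUP x. SUP vs\<in>{vs. length vs = l \<and> (\<forall>v\<in>set vs. norm v = 1)}.
        ennreal \<bar>iter_deriv h vs x\<bar>)"

definition wasserstein_test :: "nat \<Rightarrow> ('a::euclidean_space \<Rightarrow> real) set" where
  "wasserstein_test r =
     {h. continuous_on UNIV h \<and> bounded (range h) \<and> times_cont_differentiable r h \<and>
         (\<forall>l\<le>r. deriv_bound l h \<le> 1)}"

definition smooth_wasserstein ::
  "nat \<Rightarrow> 'a::euclidean_space measure \<Rightarrow> 'a measure \<Rightarrow> ennreal" where
  "smooth_wasserstein r M N =
     (SUP h\<in>wasserstein_test r. ennreal \<bar>(LINT x|M. h x) - (LINT x|N. h x)\<bar>)"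

end

theory Submission
  imports Defs "HOL-Real_Asymp.Real_Asymp"
begin

text \<open>Write $\varphi$ for the characteristic function of $X$, and for $0 < s < 1$ let $X_s$ have
  characteristic function $\varphi(\xi)/\varphi(s\xi)$, as self-decomposability allows. Since
  $\varphi(s\xi) = \exp\int(e^{is\langle\xi;u\rangle} - 1 - is\langle\xi;u\rangle)\nu(du)$, the
  derivative of $s \mapsto e^{is\langle\xi;x\rangle}/\varphi(s\xi)$, integrated over $(0,1)$, gives the
  Stein equation
  $h(x) - Eh(X) = \langle x;G(x)\rangle - \int\langle u;G(x+u)-G(x)\rangle\nu(du)$ with
  $G(x) = \int_0^1 E\nabla h(sx+X_s)ds$ for exponentials $h$. It is linear in $h$ and stable under
  bounded pointwise convergence of $h$ and $\nabla h$, so it extends to Gaussian mixtures of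
  exponentials, to Gaussian smoothings of integrable $h$, and by a cutoff to all
  $h \in \mathcal{H}_2$. The factor $s$ makes $G$ Lipschitz with constant $\int_0^1 s\,ds = 1/2$.
  Inserting $f = G$ in the definition of a Stein kernel and using Cauchy-Schwarz gives the bound,
  even with $1/2$ in place of $d/2$.\<close>

section \<open>Gaussian smoothing and Fourier inversion\<close>

text \<open>With s = e^{-t}, \<open>G\<close> is the time integral of the gradient of P_t h(x) = E
  h(e^{-t} x + X_s): the chain rule contributes a factor e^{-t}, which turns dt into -ds, and this
  is why s is uniform on (0,1). Working one frequency at a time replaces the study of this semigroup
  by the fundamental theorem of calculus in s. The drift-free exponent rests on two facts: a finite
  second moment of X passes to \<nu>, so that the truncation can be removed, and centering then
  forces the remaining linear term to vanish. Functions in the test class need not be mixtures of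
  exponentials, and the equation couples h with its gradient, so both are approximated together.
  Bounds on the two do not suffice for the limit: only |u|^2, not |u|, is known to be integrable
  under \<nu>, so increments in direction u must be O(|u|^2) uniformly. Hence a common Lipschitz
  constant of the gradients is carried through smoothing and cutoff. In the final estimate, the
  u-part of the increment of a Stein kernel reproduces the integral term of the Stein equation, and
  only the part measured by the discrepancy is left.\<close>

text \<open>In each of its applications a majorant splits into a factor for each variable, so one
  pointwise product bound delivers joint integrability, the exchange, and integrability of both
  partial integrals.\<close>

lemma Fubini_dominated:
  fixes f :: "'b \<Rightarrow> 'c \<Rightarrow> 'd::{banach, second_countable_topology}"
  assumes "sigma_finite_measure A" "sigma_finite_measure B"
    and f: "case_prod f \<in> borel_measurable (A \<Otimes>\<^sub>M B)"
    and bound: "\<And>x y. x \<in> space A \<Longrightarrow> y \<in> space B \<Longrightarrow> norm (f x y) \<le> g x * h y"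
    and g: "integrable A g" and h: "integrable B h"
  shows "integrable (A \<Otimes>\<^sub>M B) (case_prod f)"
    and "(LINT x|A. LINT y|B. f x y) = (LINT y|B. LINT x|A. f x y)"
    and "integrable A (\<lambda>x. LINT y|B. f x y)"
    and "integrable B (\<lambda>y. LINT x|A. f x y)"
proof -
  interpret pair_sigma_finite A B
    using assms(1,2) by (simp add: pair_sigma_finite_def)
  have "integrable (A \<Otimes>\<^sub>M B) (\<lambda>(x, y). g x * h y)"
  proof (rule Fubini_integrable)
    show "integrable A (\<lambda>x. LINT y|B. norm (case (x, y) of (x, y) \<Rightarrow> g x * h y))"
      using g by (simp add: abs_mult)
    show "AE x in A. integrable B (\<lambda>y. case (x, y) of (x, y) \<Rightarrow> g x * h y)"
      using h by simp
  qed (use g h in measurable)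
  then show int: "integrable (A \<Otimes>\<^sub>M B) (case_prod f)"
    by (rule Bochner_Integration.integrable_bound)
      (use f bound in \<open>auto simp: space_pair_measure intro!: AE_I2 order_trans[OF _ abs_ge_self]\<close>)
  show "(LINT x|A. LINT y|B. f x y) = (LINT y|B. LINT x|A. f x y)"
    using Fubini_integral[OF int] by simp
  show "integrable A (\<lambda>x. LINT y|B. f x y)"
    using integrable_fst[OF int] by simp
  show "integrable B (\<lambda>y. LINT x|A. f x y)"
    using integrable_snd[OF int] by simp
qed

lemma integral_lborel_prod:
  fixes f :: "'a::euclidean_space \<Rightarrow> real \<Rightarrow> complex"
  assumes [simp]: "\<And>b. b \<in> Basis \<Longrightarrow> integrable lborel (f b)"
  shows "(LINT x|lborel. (\<Prod>b\<in>Basis. f b (x \<bullet> b))) = (\<Prod>b\<in>Basis. LINT t|lborel. f b t)"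
proof -
  interpret product_sigma_finite "\<lambda>_::'a. lborel :: real measure" ..
  have [measurable]: "\<And>b. b \<in> Basis \<Longrightarrow> f b \<in> borel_measurable borel"
    using assms borel_measurable_integrable by fastforce
  show ?thesis
    by (subst lborel_eq) (simp add: integral_distr product_integral_prod)
qed

lemma lborel_integral_affine:
  fixes f :: "'a::euclidean_space \<Rightarrow> 'b::{banach, second_countable_topology}" and c :: real
  assumes c: "c \<noteq> 0" and [measurable]: "f \<in> borel_measurable borel"
  shows "(LINT x|lborel. f x) = \<bar>c\<bar> ^ DIM('a) *\<^sub>R (LINT x|lborel. f (t + c *\<^sub>R x))"
  by (subst lborel_affine[OF c, of t])
    (simp add: integral_density integral_distr)

lemma lborel_integrable_affine:
  fixes f :: "'a::euclidean_space \<Rightarrow> 'b::{banach, second_countable_topology}" and c :: real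
  assumes c: "c \<noteq> 0" and f: "integrable lborel f"
  shows "integrable lborel (\<lambda>x. f (t + c *\<^sub>R x))"
proof -
  have [measurable]: "f \<in> borel_measurable borel"
    using f borel_measurable_integrable by fastforce
  have "integrable (density (distr lborel borel (\<lambda>x. t + c *\<^sub>R x)) (\<lambda>_. \<bar>c\<bar> ^ DIM('a))) f"
    using f by (simp add: lborel_affine[OF c, of t, symmetric])
  then have "integrable lborel (\<lambda>x. \<bar>c\<bar> ^ DIM('a) *\<^sub>R f (t + c *\<^sub>R x))"
    by (simp add: integrable_density integrable_distr_eq)
  then show ?thesis
    using c integrable_scaleR_right[of "1 / \<bar>c\<bar> ^ DIM('a)" lborel
      "\<lambda>x. \<bar>c\<bar> ^ DIM('a) *\<^sub>R f (t + c *\<^sub>R x)"] by simp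
qed

text \<open>The product form reduces total mass and characteristic function to one dimension;
  \<open>gauss_eq\<close> recovers the radial form used for estimates.\<close>

definition gauss :: "'a::euclidean_space \<Rightarrow> real" where
  "gauss z = (\<Prod>b\<in>Basis. std_normal_density (z \<bullet> b))"

definition gauss_measure :: "'a::euclidean_space measure" where
  "gauss_measure = density lborel (\<lambda>z. ennreal (gauss z))"

lemma gauss_nonneg [simp]: "0 \<le> gauss z"
  by (simp add: gauss_def prod_nonneg)

lemma gauss_measurable [measurable]: "gauss \<in> borel_measurable borel"
  unfolding gauss_def[abs_def] by measurable

lemma gauss_eq:
  fixes z :: "'a::euclidean_space"
  shows "gauss z = (1 / sqrt (2 * pi)) ^ DIM('a) * exp (- (norm z)\<^sup>2 / 2)"
proof -
  have "(norm z)\<^sup>2 = (\<Sum>b\<in>Basis. (z \<bullet> b)\<^sup>2)"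
    by (simp only: power2_norm_eq_inner) (subst euclidean_inner, simp add: power2_eq_square)
  then show ?thesis
    by (simp add: gauss_def normal_density_def prod.distrib exp_sum[symmetric] sum_negf
        sum_divide_distrib[symmetric] power_one_over prod_dividef)
qed

lemma sets_gauss_measure [simp, measurable_cong]: "sets gauss_measure = sets borel"
  by (simp add: gauss_measure_def)

lemma space_gauss_measure [simp]: "space gauss_measure = UNIV"
  by (simp add: gauss_measure_def)

lemma prob_space_gauss: "prob_space (gauss_measure :: 'a::euclidean_space measure)"
proof
  have "(\<integral>\<^sup>+t. ennreal (std_normal_density t) \<partial>lborel) = 1"
    using prob_space.emeasure_space_1[OF prob_space_normal_density[of 1 0]]
    by (simp add: emeasure_density)
  then have "(\<integral>\<^sup>+z. (\<Prod>b\<in>Basis. ennreal (std_normal_density (z \<bullet> b))) \<partial>(lborel :: 'a measure)) = 1"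
    by (subst nn_integral_lborel_prod) auto
  then show "emeasure gauss_measure (space (gauss_measure :: 'a measure)) = 1"
    by (simp add: gauss_measure_def emeasure_density gauss_def prod_ennreal)
qed

lemma gauss_integral:
  fixes f :: "'a::euclidean_space \<Rightarrow> 'b::{banach, second_countable_topology}"
  assumes [measurable]: "f \<in> borel_measurable borel"
  shows "(LINT z|gauss_measure. f z) = (LINT z|lborel. gauss z *\<^sub>R f z)"
  unfolding gauss_measure_def by (rule integral_density) auto

lemma integrable_gauss: "integrable lborel (gauss :: 'a::euclidean_space \<Rightarrow> real)"
proof -
  interpret prob_space "gauss_measure :: 'a measure" by (rule prob_space_gauss)
  have "integrable (gauss_measure :: 'a measure) (\<lambda>_. 1::real)" by simp
  then show ?thesis
    by (simp add: gauss_measure_def integrable_density)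
qed

text \<open>Up to a constant factor this is \<open>gauss\<close> rescaled by
  \<open>sqrt (2 * a)\<close>.\<close>

lemma integrable_exp_norm_sq:
  assumes a: "0 < a"
  shows "integrable lborel (\<lambda>x::'a::euclidean_space. exp (- a * (norm x)\<^sup>2))"
proof -
  have "integrable lborel (\<lambda>x::'a. gauss (0 + sqrt (2 * a) *\<^sub>R x))"
    using a by (intro lborel_integrable_affine integrable_gauss) auto
  then show ?thesis
    using a by (simp add: gauss_eq power_mult_distrib)
qed

lemma gauss_charfun:
  fixes \<xi> :: "'a::euclidean_space"
  shows "(LINT z|gauss_measure. exp (\<i> * of_real (\<xi> \<bullet> z))) = of_real (exp (- (norm \<xi>)\<^sup>2 / 2))"
proof -
  have 1: "integrable lborel (\<lambda>t. of_real (std_normal_density t) * exp (\<i> * of_real (s * t)))" for s :: real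
    by (rule Bochner_Integration.integrable_bound[OF integrable_normal_density[of 1 0]])
      (auto simp: norm_mult)
  have 2: "(LINT t|lborel. of_real (std_normal_density t) * exp (\<i> * of_real (s * t)))
      = of_real (exp (- s\<^sup>2 / 2))" for s :: real
    using fun_cong[OF char_std_normal_distribution, of s]
    by (simp add: char_def integral_density scaleR_conv_of_real)
  have "(LINT z|gauss_measure. exp (\<i> * of_real (\<xi> \<bullet> z)))
      = (LINT z|lborel. (\<Prod>b\<in>Basis. of_real (std_normal_density (z \<bullet> b)) * exp (\<i> * of_real ((\<xi> \<bullet> b) * (z \<bullet> b)))))"
  proof (subst gauss_integral, simp, intro Bochner_Integration.integral_cong refl)
    fix z
    have "\<xi> \<bullet> z = (\<Sum>b\<in>Basis. (\<xi> \<bullet> b) * (z \<bullet> b))" by (rule euclidean_inner)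
    then have "exp (\<i> * of_real (\<xi> \<bullet> z)) = (\<Prod>b\<in>Basis. exp (\<i> * of_real ((\<xi> \<bullet> b) * (z \<bullet> b))))"
      by (simp add: exp_sum sum_distrib_left)
    then show "gauss z *\<^sub>R exp (\<i> * of_real (\<xi> \<bullet> z)) =
      (\<Prod>b\<in>Basis. of_real (std_normal_density (z \<bullet> b)) * exp (\<i> * of_real ((\<xi> \<bullet> b) * (z \<bullet> b))))"
      by (simp only: gauss_def prod.distrib scaleR_conv_of_real of_real_prod)
  qed
  also have "\<dots> = (\<Prod>b\<in>Basis. of_real (exp (- (\<xi> \<bullet> b)\<^sup>2 / 2)))"
    by (subst integral_lborel_prod) (simp_all only: 1 2)
  also have "\<dots> = of_real (exp (- (norm \<xi>)\<^sup>2 / 2))"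
    by (simp only: power2_norm_eq_inner) (subst euclidean_inner,
       simp add: power2_eq_square exp_sum[symmetric] sum_negf sum_divide_distrib[symmetric] of_real_prod[symmetric]
       del: of_real_prod)
  finally show ?thesis .
qed

lemma integrable_gauss_sq: "integrable (gauss_measure :: 'a::euclidean_space measure) (\<lambda>v. (norm v)\<^sup>2)"
proof -
  let ?c = "(1 / sqrt (2 * pi)) ^ DIM('a)"
  have "integrable lborel (\<lambda>x::'a. (4 * ?c) * exp (- (1/4) * (norm x)\<^sup>2))"
    by (intro integrable_mult_right integrable_exp_norm_sq) simp
  then have "integrable lborel (\<lambda>v::'a. gauss v * (norm v)\<^sup>2)"
  proof (rule Bochner_Integration.integrable_bound, measurable, intro AE_I2)
    fix x :: 'a
    \<comment> \<open>Half of the exponent, |x|^2/4, absorbs the quadratic factor through t \<le>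
      e^t; the other half remains as an integrable majorant.\<close>
    let ?t = "(norm x)\<^sup>2 / 4"
    have "?t \<le> exp ?t" using exp_ge_add_one_self[of ?t] by linarith
    then have "exp (- ?t) * ?t \<le> exp (- ?t) * exp ?t"
      by (intro mult_left_mono) auto
    then have "exp (- ?t) * ?t \<le> 1"
      by (simp add: exp_minus)
    then have *: "exp (- ?t) * (exp (- ?t) * ?t) \<le> exp (- ?t) * 1"
      by (intro mult_left_mono) auto
    have "exp (- (norm x)\<^sup>2 / 2) * (norm x)\<^sup>2 \<le> 4 * exp (- (1/4) * (norm x)\<^sup>2)"
    proof -
      have "exp (- (norm x)\<^sup>2 / 2) = exp (- ?t) * exp (- ?t)"
        by (simp flip: exp_add)
      then show ?thesis using * by simp
    qed
    then have "?c * (exp (- (norm x)\<^sup>2 / 2) * (norm x)\<^sup>2) \<le> ?c * (4 * exp (- (1/4) * (norm x)\<^sup>2))"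
      by (intro mult_left_mono) auto
    then show "norm (gauss x * (norm x)\<^sup>2) \<le> norm ((4 * ?c) * exp (- (1/4) * (norm x)\<^sup>2))"
      by (simp add: gauss_eq abs_mult mult_ac)
  qed
  then show ?thesis
    unfolding gauss_measure_def by (subst integrable_density) auto
qed

text \<open>The Fourier transform of \<open>f\<close> at the frequency \<open>k v\<close>, times (k
  / sqrt(2 pi))^d. It is the weight with which that frequency enters the average of \<open>f\<close>
  over Gaussian noise of standard deviation 1/k, when v is itself standard Gaussian.\<close>

definition gauss_weight :: "real \<Rightarrow> ('a::euclidean_space \<Rightarrow> complex) \<Rightarrow> 'a \<Rightarrow> complex" where
  "gauss_weight k f v = of_real ((1 / sqrt (2 * pi)) ^ DIM('a) * k ^ DIM('a)) *
     (LINT y|lborel. f y * exp (- (\<i> * of_real (k * (v \<bullet> y)))))"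

text \<open>The Gaussian density is, up to a constant, its own characteristic function. Writing it
  that way and exchanging integrals exhibits the smoothing of \<open>f\<close> as a mixture of
  exponentials, with integrability of \<open>f\<close> alone and none of its Fourier
  transform.\<close>

lemma gauss_smoothing:
  fixes f :: "'a::euclidean_space \<Rightarrow> complex"
  assumes f: "integrable lborel f" and k: "0 < k"
  shows "(LINT z|gauss_measure. f (x + (1 / k) *\<^sub>R z)) =
    (LINT v|gauss_measure. gauss_weight k f v * exp (\<i> * of_real (k * (v \<bullet> x))))"
proof -
  define c where "c = (1 / sqrt (2 * pi)) ^ DIM('a)"
  have c0: "0 \<le> c" by (simp add: c_def)
  interpret G: prob_space "gauss_measure :: 'a measure" by (rule prob_space_gauss)
  have [measurable]: "f \<in> borel_measurable borel"
    using f borel_measurable_integrable by fastforce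
  have g: "of_real (gauss (k *\<^sub>R (y - x))) =
      of_real c * (LINT v|gauss_measure. exp (\<i> * of_real ((k *\<^sub>R (x - y)) \<bullet> v)))" for y
    unfolding gauss_charfun gauss_eq c_def by (simp add: norm_minus_commute)
  have "(LINT z|gauss_measure. f (x + (1 / k) *\<^sub>R z)) = (LINT z|lborel. gauss z *\<^sub>R f (x + (1 / k) *\<^sub>R z))"
    by (rule gauss_integral) simp
  also have "\<dots> = of_real (k ^ DIM('a)) * (LINT y|lborel. gauss (k *\<^sub>R (y - x)) *\<^sub>R f y)"
    \<comment> \<open>Substituting y = x + z/k produces the Jacobian k^d.\<close>
    using k by (subst lborel_integral_affine[of "1/k" _ x])
      (simp_all add: scaleR_conv_of_real power_one_over)
  also have "(LINT y|lborel. gauss (k *\<^sub>R (y - x)) *\<^sub>R f y) =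
     (LINT y|lborel. LINT v|gauss_measure. of_real c * f y * exp (\<i> * of_real ((k *\<^sub>R (x - y)) \<bullet> v)))"
    unfolding scaleR_conv_of_real g by (simp add: mult_ac)
  also have "\<dots> = (LINT v|gauss_measure. LINT y|lborel. of_real c * f y * exp (\<i> * of_real ((k *\<^sub>R (x - y)) \<bullet> v)))"
    by (rule Fubini_dominated[where g="\<lambda>y. c * norm (f y)" and h="\<lambda>_. 1"])
      (use f c0 in \<open>auto simp: norm_mult sigma_finite_lborel norm_exp_i_times mult.commute[of c] simp del: of_real_mult intro!: G.sigma_finite_measure_axioms\<close>)
  also have "of_real (k ^ DIM('a)) * \<dots> =
     (LINT v|gauss_measure. of_real (k ^ DIM('a)) * (LINT y|lborel. of_real c * f y * exp (\<i> * of_real ((k *\<^sub>R (x - y)) \<bullet> v))))"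
    by simp
  also have "\<dots> = (LINT v|gauss_measure. gauss_weight k f v * exp (\<i> * of_real (k * (v \<bullet> x))))"
  proof (intro Bochner_Integration.integral_cong refl)
    fix v :: 'a
    have "(LINT y|lborel. of_real c * f y * exp (\<i> * of_real ((k *\<^sub>R (x - y)) \<bullet> v)))
      = (LINT y|lborel. (of_real c * exp (\<i> * of_real (k * (v \<bullet> x)))) * (f y * exp (- (\<i> * of_real (k * (v \<bullet> y))))))"
      by (intro Bochner_Integration.integral_cong refl)
        (simp add: inner_diff_left inner_commute[of v] right_diff_distrib exp_diff exp_minus divide_inverse mult_ac)
    also have "\<dots> = of_real c * exp (\<i> * of_real (k * (v \<bullet> x))) * (LINT y|lborel. f y * exp (- (\<i> * of_real (k * (v \<bullet> y)))))"
      by (rule integral_mult_right_zero)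
    finally show "of_real (k ^ DIM('a)) * (LINT y|lborel. of_real c * f y * exp (\<i> * of_real ((k *\<^sub>R (x - y)) \<bullet> v)))
       = gauss_weight k f v * exp (\<i> * of_real (k * (v \<bullet> x)))"
      by (simp add: gauss_weight_def c_def mult_ac)
  qed
  finally show ?thesis .
qed

lemma gauss_weight_bound:
  fixes f :: "'a::euclidean_space \<Rightarrow> complex"
  assumes f: "integrable lborel f" and k: "0 < k"
  obtains C where "0 \<le> C" "\<And>v. norm (gauss_weight k f v) \<le> C"
proof
  let ?c = "(1 / sqrt (2 * pi)) ^ DIM('a) * k ^ DIM('a)"
  have c: "0 \<le> ?c" using k by simp
  show "0 \<le> ?c * (LINT y|lborel. norm (f y))" using k by simp
  fix v
  have "norm (LINT y|lborel. f y * exp (- (\<i> * of_real (k * (v \<bullet> y))))) \<le> (LINT y|lborel. norm (f y))"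
    using integral_norm_bound[of lborel "\<lambda>y. f y * exp (- (\<i> * of_real (k * (v \<bullet> y))))"]
    by (simp add: norm_mult)
  then show "norm (gauss_weight k f v) \<le> ?c * (LINT y|lborel. norm (f y))"
    unfolding gauss_weight_def norm_mult norm_of_real abs_of_nonneg[OF c]
    using c by (intro mult_left_mono)
qed

lemma gauss_weight_measurable [measurable]:
  fixes f :: "'a::euclidean_space \<Rightarrow> complex"
  assumes [measurable]: "f \<in> borel_measurable borel"
  shows "gauss_weight k f \<in> borel_measurable borel"
  unfolding gauss_weight_def[abs_def] by measurable

lemma gauss_smoothing_tendsto:
  fixes f :: "'a::euclidean_space \<Rightarrow> 'b::{banach, second_countable_topology}"
  assumes f: "continuous_on UNIV f" and B: "\<And>x. norm (f x) \<le> B"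
  shows "(\<lambda>n. LINT z|gauss_measure. f (x + (1 / real (Suc n)) *\<^sub>R z)) \<longlonglongrightarrow> f x"
proof -
  interpret G: prob_space "gauss_measure :: 'a measure" by (rule prob_space_gauss)
  have [measurable]: "f \<in> borel_measurable borel"
    using f by (rule borel_measurable_continuous_onI)
  have "(\<lambda>n. LINT z|gauss_measure. f (x + (1 / real (Suc n)) *\<^sub>R z)) \<longlonglongrightarrow> (LINT z|(gauss_measure::'a measure). f x)"
  proof (rule integral_dominated_convergence[where w="\<lambda>_. B"])
    show "AE z in gauss_measure. (\<lambda>n. f (x + (1 / real (Suc n)) *\<^sub>R z)) \<longlonglongrightarrow> f x"
    proof (intro AE_I2)
      fix z :: 'a
      have "(\<lambda>n. x + (1 / real (Suc n)) *\<^sub>R z) \<longlonglongrightarrow> x + 0 *\<^sub>R z"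
        by (intro tendsto_intros LIMSEQ_Suc[OF lim_1_over_n])
      moreover have "isCont f x"
        using f by (simp add: continuous_on_eq_continuous_at)
      ultimately show "(\<lambda>n. f (x + (1 / real (Suc n)) *\<^sub>R z)) \<longlonglongrightarrow> f x"
        by (auto intro: isCont_tendsto_compose)
    qed
  qed (use B in auto)
  then show ?thesis using G.prob_space by simp
qed

section \<open>Second moment and exponent of the Levy measure\<close>

text \<open>Integrating a second-order Taylor bound yields an error of order h^2 directly, so the
  derivative has to be integrable only at \<open>s\<close> itself and no majorant near
  \<open>s\<close> is required.\<close>

lemma has_vector_derivative_integral_quadratic:
  fixes F :: "real \<Rightarrow> 'b \<Rightarrow> 'c::{banach, second_countable_topology}"
  assumes F: "\<And>t. integrable M (F t)" and F': "integrable M F'" and g: "integrable M g"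
    and bound: "\<And>h x. norm (F (s + h) x - F s x - h *\<^sub>R F' x) \<le> h\<^sup>2 * g x"
  shows "((\<lambda>t. LINT x|M. F t x) has_vector_derivative (LINT x|M. F' x)) (at s)"
proof -
  let ?I = "\<lambda>t. LINT x|M. F t x" and ?G = "LINT x|M. g x"
  have *: "norm (?I (s + h) - ?I s - h *\<^sub>R (LINT x|M. F' x)) \<le> h\<^sup>2 * ?G" for h
  proof -
    have "?I (s + h) - ?I s - h *\<^sub>R (LINT x|M. F' x) = (LINT x|M. F (s + h) x - F s x - h *\<^sub>R F' x)"
      using F F' by simp
    also have "norm \<dots> \<le> (LINT x|M. h\<^sup>2 * g x)"
      by (rule order_trans[OF integral_norm_bound integral_mono]) (use F F' g bound in auto)
    finally show ?thesis by simp
  qed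
  have "(\<lambda>h. norm (?I (s + h) - ?I s - h *\<^sub>R (LINT x|M. F' x)) / norm h) \<midarrow>0\<rightarrow> 0"
  proof (rule Lim_null_comparison)
    show "\<forall>\<^sub>F h in at 0. norm (norm (?I (s + h) - ?I s - h *\<^sub>R (LINT x|M. F' x)) / norm h) \<le> \<bar>h\<bar> * ?G"
    proof (intro eventuallyI)
      fix h :: real
      have "h\<^sup>2 = \<bar>h\<bar> * \<bar>h\<bar>" by (simp add: power2_eq_square)
      with *[of h] show "norm (norm (?I (s + h) - ?I s - h *\<^sub>R (LINT x|M. F' x)) / norm h) \<le> \<bar>h\<bar> * ?G"
        by (cases "h = 0") (simp_all add: divide_le_eq mult_ac)
    qed
    show "(\<lambda>h. \<bar>h\<bar> * ?G) \<midarrow>0\<rightarrow> 0"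
      by (intro tendsto_eq_intros) auto
  qed
  then show ?thesis
    unfolding has_vector_derivative_def has_derivative_at
    by (simp add: bounded_linear_scaleR_left)
qed

section \<open>Taylor bounds for the imaginary exponential\<close>

lemma iexp_bound2: "norm (exp (\<i> * of_real t) - 1 - \<i> * of_real t) \<le> t\<^sup>2 / 2" for t :: real
  using iexp_approx1[of t 1] by (simp add: numeral_2_eq_2 algebra_simps)

lemma iexp_bound2': "norm (exp (\<i> * of_real t) - 1 - \<i> * of_real t) \<le> t\<^sup>2" for t :: real
  by (rule order_trans[OF iexp_bound2]) simp

lemma iexp_bound1: "norm (exp (\<i> * of_real t) - 1) \<le> \<bar>t\<bar>" for t :: real
  using iexp_approx1[of t 0] by simp

lemma inner_sq_le: "(x \<bullet> y)\<^sup>2 \<le> (norm x)\<^sup>2 * (norm y)\<^sup>2" for x y :: "'a::real_inner"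
  using Cauchy_Schwarz_ineq[of x y] by (simp add: power2_norm_eq_inner)

definition levy_kernel :: "'a::euclidean_space \<Rightarrow> 'a \<Rightarrow> complex" where
  "levy_kernel \<xi> u = exp (\<i> * of_real (\<xi> \<bullet> u)) - 1
     - \<i> * of_real ((\<xi> \<bullet> u) * indicator (cball 0 1) u)"

lemma levy_kernel_integrable:
  assumes \<nu>: "levy_measure (\<nu> :: 'a::euclidean_space measure)"
  shows "integrable \<nu> (levy_kernel \<xi>)"
proof -
  have [measurable_cong]: "sets \<nu> = sets borel" using \<nu> by (simp add: levy_measure_def)
  \<comment> \<open>The summand |\<xi>|^2 serves inside the unit ball, where the kernel is a
    second-order remainder; the summand 2 serves outside, where the kernel is e^{i<\<xi>;u>} -
    1.\<close>
  have "integrable \<nu> (\<lambda>u. (2 + (norm \<xi>)\<^sup>2) * min 1 ((norm u)\<^sup>2))"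
    using \<nu> by (intro integrable_mult_right integrableI_nonneg) (auto simp: levy_measure_def)
  then show ?thesis
  proof (rule Bochner_Integration.integrable_bound)
    have [measurable]: "cball (0::'a) 1 \<in> sets borel" by simp
    show "levy_kernel \<xi> \<in> borel_measurable \<nu>"
      unfolding levy_kernel_def[abs_def] by measurable
    show "AE u in \<nu>. norm (levy_kernel \<xi> u) \<le> norm ((2 + (norm \<xi>)\<^sup>2) * min 1 ((norm u)\<^sup>2))"
    proof (intro AE_I2)
      fix u
      show "norm (levy_kernel \<xi> u) \<le> norm ((2 + (norm \<xi>)\<^sup>2) * min 1 ((norm u)\<^sup>2))"
      proof (cases "norm u \<le> 1")
        case True
        then have "norm (levy_kernel \<xi> u) \<le> (norm \<xi>)\<^sup>2 * (norm u)\<^sup>2"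
          using order_trans[OF iexp_bound2' inner_sq_le, of \<xi> u] by (simp add: levy_kernel_def)
        also have "\<dots> \<le> (2 + (norm \<xi>)\<^sup>2) * (norm u)\<^sup>2"
          by (intro mult_right_mono) auto
        finally show ?thesis
          using True by (simp add: min_absorb2 abs_mult power_le_one)
      next
        case False
        then have "norm (levy_kernel \<xi> u) \<le> 2"
          using norm_triangle_ineq4[of "exp (\<i> * of_real (\<xi> \<bullet> u))" 1] by (simp add: levy_kernel_def)
        moreover have "1 \<le> (norm u)\<^sup>2" using False by (intro one_le_power) simp
        ultimately show ?thesis by (simp add: min_absorb1 abs_mult add_increasing2)
      qed
    qed
  qed
qed

lemma levy_kernel_Re: "Re (levy_kernel \<xi> u) = - (1 - cos (\<xi> \<bullet> u))"
  by (simp add: levy_kernel_def Re_exp)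

text \<open>The first-order term of the exponential is imaginary, so the real part departs from 1
  only by the second moment.\<close>

lemma charfun_Re_lower:
  assumes M: "borel_prob M" and 2: "finite_second_moment M"
  shows "1 - (norm \<xi>)\<^sup>2 * (LINT x|M. (norm x)\<^sup>2) / 2 \<le> norm (charfun M \<xi>)"
proof -
  interpret prob_space M using M by (simp add: borel_prob_def)
  have [measurable_cong]: "sets M = sets borel" using M by (simp add: borel_prob_def)
  have i2: "integrable M (\<lambda>x. (norm x)\<^sup>2)" using 2 by (simp add: finite_second_moment_def)
  have ie: "integrable M (\<lambda>x. exp (\<i> * of_real (\<xi> \<bullet> x)))"
    by (rule integrable_const_bound[of _ 1]) auto
  have le: "1 - (norm \<xi>)\<^sup>2 * (norm x)\<^sup>2 / 2 \<le> cos (\<xi> \<bullet> x)" for x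
  proof -
    have "\<bar>Re (exp (\<i> * of_real (\<xi> \<bullet> x)) - 1 - \<i> * of_real (\<xi> \<bullet> x))\<bar> \<le> (\<xi> \<bullet> x)\<^sup>2 / 2"
      using iexp_bound2[of "\<xi> \<bullet> x"] abs_Re_le_cmod order_trans by blast
    then show ?thesis using inner_sq_le[of \<xi> x] by (simp add: Re_exp)
  qed
  have "1 - (norm \<xi>)\<^sup>2 * (LINT x|M. (norm x)\<^sup>2) / 2 = (LINT x|M. 1 - (norm \<xi>)\<^sup>2 * (norm x)\<^sup>2 / 2)"
    using i2 prob_space by simp
  also have "\<dots> \<le> (LINT x|M. cos (\<xi> \<bullet> x))"
    by (rule integral_mono) (use i2 le in \<open>auto intro!: integrable_const_bound[of _ 1]\<close>)
  also have "\<dots> = Re (charfun M \<xi>)"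
    unfolding charfun_def using integral_Re[OF ie] by (simp add: Re_exp)
  also have "\<dots> \<le> norm (charfun M \<xi>)" by (rule complex_Re_le_cmod)
  finally show ?thesis .
qed

text \<open>Comparing $|\varphi(\xi/n)| = \exp(-\int (1-\cos\langle\xi;u\rangle/n)\,d\nu)$ with
  $1 - O(n^{-2})$ and letting $n \to \infty$ in Fatou's lemma.\<close>

lemma levy_second_moment_dir:
  assumes ID: "infinitely_divisible_law M b (\<lambda>_. 0) \<nu>" and 2: "finite_second_moment M"
  shows "(\<integral>\<^sup>+u. ennreal ((\<xi> \<bullet> u)\<^sup>2 / 2) \<partial>\<nu>) < \<infinity>"
proof -
  have M: "borel_prob M" and L: "levy_measure \<nu>"
    and cf: "charfun M \<xi> = exp (\<i> * of_real (b \<bullet> \<xi>) + (LINT u|\<nu>. levy_kernel \<xi> u))" for \<xi>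
    using ID by (auto simp: infinitely_divisible_law_def levy_kernel_def)
  have [measurable_cong]: "sets \<nu> = sets borel" using L by (simp add: levy_measure_def)
  define m where "m = (norm \<xi>)\<^sup>2 * (LINT x|M. (norm x)\<^sup>2)"
  have m0: "0 \<le> m" by (simp add: m_def)
  define J where "J \<eta> = (LINT u|\<nu>. 1 - cos (\<eta> \<bullet> u))" for \<eta>
  have iJ: "integrable \<nu> (\<lambda>u. 1 - cos (\<eta> \<bullet> u))" for \<eta>
    using integrable_minus[OF integrable_Re[OF levy_kernel_integrable[OF L, of \<eta>]]]
    by (simp add: levy_kernel_def Re_exp)
  have J0: "0 \<le> J \<eta>" for \<eta> by (simp add: J_def)
  \<comment> \<open>Taking the modulus removes the drift and the truncation term, which are purely
    imaginary.\<close>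
  have nc: "norm (charfun M \<eta>) = exp (- J \<eta>)" for \<eta>
  proof -
    have "Re (LINT u|\<nu>. levy_kernel \<eta> u) = (LINT u|\<nu>. - (1 - cos (\<eta> \<bullet> u)))"
      using integral_Re[OF levy_kernel_integrable[OF L, of \<eta>]]
      by (simp only: levy_kernel_Re)
    then show ?thesis unfolding cf norm_exp_eq_Re J_def by (simp del: minus_diff_eq)
  qed
  \<comment> \<open>The condition n > 1 + m gives n^2 > m, so that 1 - m/(2 n^2) exceeds 1/2 and can
    be divided out.\<close>
  have Jb: "J ((1 / real n) *\<^sub>R \<xi>) * (real n)\<^sup>2 \<le> m" if n: "real n > 1 + m" for n
  proof -
    let ?J = "J ((1 / real n) *\<^sub>R \<xi>)" and ?x = "m / (real n)\<^sup>2"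
    have "real n \<le> (real n)\<^sup>2"
      by (rule self_le_power) (use n m0 in auto)
    then have n2: "(real n)\<^sup>2 > m" "0 < real n"
      using n m0 by linarith+
    have x: "0 \<le> ?x" "?x < 1" using n2 m0 by auto
    have "1 - ?x / 2 \<le> norm (charfun M ((1 / real n) *\<^sub>R \<xi>))"
      using charfun_Re_lower[OF M 2, of "(1 / real n) *\<^sub>R \<xi>"]
      by (simp add: m_def power_divide power_mult_distrib)
    \<comment> \<open>Multiplying by 1 + J \<le> e^J turns the lower bound on e^{-J} into an upper
      bound on J without logarithms.\<close>
    then have "(1 - ?x / 2) * (1 + ?J) \<le> exp (- ?J) * exp ?J"
      unfolding nc using J0[of "(1 / real n) *\<^sub>R \<xi>"] by (intro mult_mono exp_ge_add_one_self) auto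
    then have "(1 - ?x / 2) * (1 + ?J) \<le> 1" by (simp flip: exp_add)
    then have "?J * (1 - ?x / 2) \<le> ?x / 2"
      unfolding distrib_left left_diff_distrib right_diff_distrib mult_1_right mult_1_left
      by (simp only: mult.commute[of _ ?J])
    moreover have "?J * (1/2) \<le> ?J * (1 - ?x / 2)"
      using J0 x by (intro mult_left_mono) auto
    ultimately have "?J \<le> ?x" by simp
    then show ?thesis using n2 by (simp add: field_simps)
  qed
  define f where "f n u = ennreal ((1 - cos (((1 / real n) *\<^sub>R \<xi>) \<bullet> u)) * (real n)\<^sup>2)" for n u
  have "(\<integral>\<^sup>+u. ennreal ((\<xi> \<bullet> u)\<^sup>2 / 2) \<partial>\<nu>) = (\<integral>\<^sup>+u. liminf (\<lambda>n. f n u) \<partial>\<nu>)"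
  proof (intro nn_integral_cong)
    fix u
    have "(\<lambda>n. (1 - cos ((1 / real n) * a)) * (real n)\<^sup>2) \<longlonglongrightarrow> a * a / 2" for a :: real
      by (cases "a = 0") (simp, real_asymp)
    from this[of "\<xi> \<bullet> u"]
    have "(\<lambda>n. (1 - cos ((1 / real n) * (\<xi> \<bullet> u))) * (real n)\<^sup>2) \<longlonglongrightarrow> (\<xi> \<bullet> u)\<^sup>2 / 2"
      by (simp add: power2_eq_square)
    then have "(\<lambda>n. f n u) \<longlonglongrightarrow> ennreal ((\<xi> \<bullet> u)\<^sup>2 / 2)"
      unfolding f_def by (intro tendsto_ennrealI) simp
    then show "ennreal ((\<xi> \<bullet> u)\<^sup>2 / 2) = liminf (\<lambda>n. f n u)"
      by (simp add: lim_imp_Liminf)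
  qed
  also have "\<dots> \<le> liminf (\<lambda>n. \<integral>\<^sup>+u. f n u \<partial>\<nu>)"
    by (rule nn_integral_liminf) (auto simp: f_def)
  also have "\<dots> \<le> ennreal m"
  proof (rule Liminf_le)
    obtain n0 where n0: "1 + m < real n0" using reals_Archimedean2 by blast
    show "\<forall>\<^sub>F n in sequentially. (\<integral>\<^sup>+u. f n u \<partial>\<nu>) \<le> ennreal m"
    proof (intro eventually_sequentiallyI[of n0])
      fix n assume "n0 \<le> n"
      then have "1 + m < real n" using n0 by linarith
      from Jb[OF this] show "(\<integral>\<^sup>+u. f n u \<partial>\<nu>) \<le> ennreal m"
        unfolding f_def J_def using iJ[of "(1 / real n) *\<^sub>R \<xi>"]
        by (subst nn_integral_eq_integral) (auto intro!: ennreal_leI)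
    qed
  qed auto
  finally show ?thesis by (simp add: less_top order_le_less_trans)
qed

lemma levy_second_moment:
  fixes M :: "'a::euclidean_space measure"
  assumes ID: "infinitely_divisible_law M b (\<lambda>_. 0) \<nu>" and 2: "finite_second_moment M"
  shows "integrable \<nu> (\<lambda>u. (norm u)\<^sup>2)"
proof -
  have [measurable_cong]: "sets \<nu> = sets borel"
    using ID by (simp add: infinitely_divisible_law_def levy_measure_def)
  have "integrable \<nu> (\<lambda>u. 2 * ((i \<bullet> u)\<^sup>2 / 2))" for i :: 'a
    by (intro integrable_mult_right integrableI_nonneg)
      (use levy_second_moment_dir[OF ID 2, of i] in auto)
  then have "integrable \<nu> (\<lambda>u. \<Sum>i\<in>Basis. (i \<bullet> u)\<^sup>2)" by simp
  moreover have "(\<Sum>i\<in>Basis. (i \<bullet> u)\<^sup>2) = (norm u)\<^sup>2" for u :: 'a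
    by (simp only: power2_norm_eq_inner) (subst euclidean_inner, simp add: power2_eq_square inner_commute)
  ultimately show ?thesis by simp
qed

text \<open>By Markov's inequality each set \<open>A n\<close> has finite measure; these sets
  exhaust the complement of the origin, which is a null set. The result licenses every exchange of
  \<nu> with another integral.\<close>

lemma sigma_finite_levy:
  fixes \<nu> :: "'a::euclidean_space measure"
  assumes \<nu>: "levy_measure \<nu>" and i: "integrable \<nu> (\<lambda>u. (norm u)\<^sup>2)"
  shows "sigma_finite_measure \<nu>"
proof
  have S[measurable_cong]: "sets \<nu> = sets borel" and z: "emeasure \<nu> {0} = 0"
    using \<nu> by (auto simp: levy_measure_def)
  define A where "A n = {u::'a. 1 \<le> real (Suc n) * (norm u)\<^sup>2}" for n
  have Am: "A n \<in> sets \<nu>" for n unfolding A_def S by measurable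
  show "\<exists>\<A>. countable \<A> \<and> \<A> \<subseteq> sets \<nu> \<and> \<Union> \<A> = space \<nu> \<and> (\<forall>a\<in>\<A>. emeasure \<nu> a \<noteq> \<infinity>)"
  proof (intro exI[of _ "insert {0} (range A)"] conjI ballI)
    show "\<Union> (insert {0} (range A)) = space \<nu>"
    proof -
      have "u \<in> \<Union> (range A)" if "u \<noteq> 0" for u
      proof -
        obtain n where "1 / (norm u)\<^sup>2 < real n" using reals_Archimedean2 by blast
        then have "1 < real n * (norm u)\<^sup>2" using that by (simp add: divide_simps)
        also have "\<dots> \<le> real (Suc n) * (norm u)\<^sup>2" by (intro mult_right_mono) auto
        finally have "u \<in> A n" by (simp add: A_def)
        then show ?thesis by blast
      qed
      then show ?thesis using S by (auto simp: sets_eq_imp_space_eq[OF S])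
    qed
    fix a assume "a \<in> insert {0} (range A)"
    then consider "a = {0}" | n where "a = A n" by auto
    then show "emeasure \<nu> a \<noteq> \<infinity>"
    proof cases
      case 2
      have "emeasure \<nu> (A n) = emeasure \<nu> {u\<in>space \<nu>. 1 \<le> ennreal (real (Suc n)) * ennreal ((norm u)\<^sup>2)}"
        by (intro arg_cong[where f="emeasure \<nu>"])
          (simp add: A_def sets_eq_imp_space_eq[OF S] ennreal_ge_1 del: of_nat_Suc flip: ennreal_mult')
      also have "\<dots> \<le> ennreal (real (Suc n)) * (\<integral>\<^sup>+u. ennreal ((norm u)\<^sup>2) * indicator (space \<nu>) u \<partial>\<nu>)"
        by (rule order_trans[OF _ nn_integral_Markov_inequality]) auto
      also have "\<dots> < \<infinity>"
        using i by (auto simp: integrable_iff_bounded ennreal_mult_less_top cong: nn_integral_cong)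
      finally show ?thesis using 2 by simp
    qed (use z in simp)
  qed (use Am S in auto)
qed

text \<open>The compensator is not truncated to the unit ball, which the second moment of \<nu>
  permits. The scalar \<open>s\<close> is kept apart because the exponent is differentiated along
  the ray through \<xi>.\<close>

definition levy_exponent :: "'a::euclidean_space measure \<Rightarrow> 'a \<Rightarrow> real \<Rightarrow> complex" where
  "levy_exponent \<nu> \<xi> s =
     (LINT u|\<nu>. exp (\<i> * of_real (s * (\<xi> \<bullet> u))) - 1 - \<i> * of_real (s * (\<xi> \<bullet> u)))"

definition levy_exponent_deriv :: "'a::euclidean_space measure \<Rightarrow> 'a \<Rightarrow> real \<Rightarrow> complex" where
  "levy_exponent_deriv \<nu> \<xi> s =
     (LINT u|\<nu>. \<i> * of_real (\<xi> \<bullet> u) * (exp (\<i> * of_real (s * (\<xi> \<bullet> u))) - 1))"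

lemma iexp_increment_bound:
  fixes a s h :: real
  shows "norm (exp (\<i> * of_real ((s + h) * a)) - exp (\<i> * of_real (s * a))
      - h *\<^sub>R (\<i> * of_real a * exp (\<i> * of_real (s * a)))) \<le> h\<^sup>2 * a\<^sup>2"
proof -
  have "exp (\<i> * of_real ((s + h) * a)) - exp (\<i> * of_real (s * a))
      - h *\<^sub>R (\<i> * of_real a * exp (\<i> * of_real (s * a)))
     = exp (\<i> * of_real (s * a)) * (exp (\<i> * of_real (h * a)) - 1 - \<i> * of_real (h * a))"
    by (simp add: algebra_simps scaleR_conv_of_real exp_add)
  also have "norm \<dots> \<le> (h * a)\<^sup>2 / 2"
    unfolding norm_mult using iexp_bound2[of "h * a"] by (simp del: of_real_mult)
  also have "\<dots> \<le> h\<^sup>2 * a\<^sup>2" by (simp add: power_mult_distrib)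
  finally show ?thesis .
qed

section \<open>Calculus of the fully compensated exponent\<close>

context
  fixes \<nu> :: "'a::euclidean_space measure"
  assumes S[measurable_cong]: "sets \<nu> = sets borel" and i: "integrable \<nu> (\<lambda>u. (norm u)\<^sup>2)"
begin

lemma integrable_levy_quadratic:
  assumes "f \<in> borel_measurable borel" and "\<And>u. norm (f u) \<le> C * (norm u)\<^sup>2"
  shows "integrable \<nu> (f :: 'a \<Rightarrow> 'b::{banach, second_countable_topology})"
  by (rule Bochner_Integration.integrable_bound[OF integrable_mult_right[OF i, of C]])
    (use assms measurable_cong_sets[OF S refl] in \<open>auto intro!: AE_I2 order_trans[OF _ abs_ge_self]\<close>)

lemma integrable_levy_exponent:
  "integrable \<nu> (\<lambda>u. exp (\<i> * of_real (s * (\<xi> \<bullet> u))) - 1 - \<i> * of_real (s * (\<xi> \<bullet> u)))"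
proof (rule integrable_levy_quadratic[where C="s\<^sup>2 * (norm \<xi>)\<^sup>2"])
  fix u
  show "norm (exp (\<i> * of_real (s * (\<xi> \<bullet> u))) - 1 - \<i> * of_real (s * (\<xi> \<bullet> u))) \<le> s\<^sup>2 * (norm \<xi>)\<^sup>2 * (norm u)\<^sup>2"
    using iexp_bound2'[of "s * (\<xi> \<bullet> u)"] mult_left_mono[OF inner_sq_le[of \<xi> u] zero_le_power2[of s]]
    unfolding power_mult_distrib mult.assoc by linarith
qed measurable

lemma norm_levy_exponent_deriv_integrand:
  "norm (\<i> * of_real (\<xi> \<bullet> u) * (exp (\<i> * of_real (s * (\<xi> \<bullet> u))) - 1)) \<le> \<bar>s\<bar> * (norm \<xi>)\<^sup>2 * (norm u)\<^sup>2"
proof -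
  have "norm (\<i> * of_real (\<xi> \<bullet> u) * (exp (\<i> * of_real (s * (\<xi> \<bullet> u))) - 1)) \<le> \<bar>\<xi> \<bullet> u\<bar> * \<bar>s * (\<xi> \<bullet> u)\<bar>"
    using iexp_bound1[of "s * (\<xi> \<bullet> u)"] by (auto simp: norm_mult intro!: mult_left_mono)
  also have "\<dots> = \<bar>s\<bar> * (\<xi> \<bullet> u)\<^sup>2" by (simp add: abs_mult power2_eq_square)
  also have "\<dots> \<le> \<bar>s\<bar> * ((norm \<xi>)\<^sup>2 * (norm u)\<^sup>2)"
    by (intro mult_left_mono inner_sq_le) auto
  finally show ?thesis by (simp add: mult.assoc)
qed

lemma integrable_levy_exponent_deriv:
  "integrable \<nu> (\<lambda>u. \<i> * of_real (\<xi> \<bullet> u) * (exp (\<i> * of_real (s * (\<xi> \<bullet> u))) - 1))"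
  by (rule integrable_levy_quadratic[OF _ norm_levy_exponent_deriv_integrand]) measurable

lemma levy_exponent_has_derivative:
  "(levy_exponent \<nu> \<xi> has_vector_derivative levy_exponent_deriv \<nu> \<xi> s) (at s)"
  unfolding levy_exponent_def[abs_def] levy_exponent_deriv_def
proof (rule has_vector_derivative_integral_quadratic[where g="\<lambda>u. (norm \<xi>)\<^sup>2 * (norm u)\<^sup>2"])
  fix h u
  \<comment> \<open>The compensator is affine in s and therefore drops out of the Taylor
    remainder.\<close>
  have "norm (exp (\<i> * of_real ((s + h) * (\<xi> \<bullet> u))) - 1 - \<i> * of_real ((s + h) * (\<xi> \<bullet> u)) -
      (exp (\<i> * of_real (s * (\<xi> \<bullet> u))) - 1 - \<i> * of_real (s * (\<xi> \<bullet> u))) -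
      h *\<^sub>R (\<i> * of_real (\<xi> \<bullet> u) * (exp (\<i> * of_real (s * (\<xi> \<bullet> u))) - 1)))
    = norm (exp (\<i> * of_real ((s + h) * (\<xi> \<bullet> u))) - exp (\<i> * of_real (s * (\<xi> \<bullet> u)))
      - h *\<^sub>R (\<i> * of_real (\<xi> \<bullet> u) * exp (\<i> * of_real (s * (\<xi> \<bullet> u)))))"
    by (simp add: algebra_simps scaleR_conv_of_real)
  also have "\<dots> \<le> h\<^sup>2 * (\<xi> \<bullet> u)\<^sup>2" by (rule iexp_increment_bound)
  also have "\<dots> \<le> h\<^sup>2 * ((norm \<xi>)\<^sup>2 * (norm u)\<^sup>2)"
    by (intro mult_left_mono inner_sq_le) auto
  finally show "norm (exp (\<i> * of_real ((s + h) * (\<xi> \<bullet> u))) - 1 - \<i> * of_real ((s + h) * (\<xi> \<bullet> u)) -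
      (exp (\<i> * of_real (s * (\<xi> \<bullet> u))) - 1 - \<i> * of_real (s * (\<xi> \<bullet> u))) -
      h *\<^sub>R (\<i> * of_real (\<xi> \<bullet> u) * (exp (\<i> * of_real (s * (\<xi> \<bullet> u))) - 1)))
    \<le> h\<^sup>2 * ((norm \<xi>)\<^sup>2 * (norm u)\<^sup>2)" .
qed (use i integrable_levy_exponent integrable_levy_exponent_deriv in auto)

lemma continuous_levy_exponent_deriv: "continuous_on UNIV (levy_exponent_deriv \<nu> \<xi>)"
proof -
  define C where "C = (norm \<xi>)\<^sup>2 * (LINT u|\<nu>. (norm u)\<^sup>2)"
  have C0: "0 \<le> C" by (simp add: C_def)
  have "dist (levy_exponent_deriv \<nu> \<xi> s) (levy_exponent_deriv \<nu> \<xi> t) \<le> C * dist s t" for s t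
  proof -
    have "levy_exponent_deriv \<nu> \<xi> s - levy_exponent_deriv \<nu> \<xi> t
      = (LINT u|\<nu>. \<i> * of_real (\<xi> \<bullet> u) * (exp (\<i> * of_real (s * (\<xi> \<bullet> u))) - 1) -
          \<i> * of_real (\<xi> \<bullet> u) * (exp (\<i> * of_real (t * (\<xi> \<bullet> u))) - 1))"
      unfolding levy_exponent_deriv_def using integrable_levy_exponent_deriv by simp
    also have "norm \<dots> \<le> (LINT u|\<nu>. (\<bar>s - t\<bar> * (norm \<xi>)\<^sup>2) * (norm u)\<^sup>2)"
    proof (rule Bochner_Integration.integral_norm_bound_integral)
      fix u
      \<comment> \<open>Factoring out a unimodular exponential leaves the same integrand at s - t,
        whose quadratic bound gives a Lipschitz estimate in s.\<close>
      have "\<i> * of_real (\<xi> \<bullet> u) * (exp (\<i> * of_real (s * (\<xi> \<bullet> u))) - 1) -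
          \<i> * of_real (\<xi> \<bullet> u) * (exp (\<i> * of_real (t * (\<xi> \<bullet> u))) - 1)
        = exp (\<i> * of_real (t * (\<xi> \<bullet> u))) * (\<i> * of_real (\<xi> \<bullet> u) * (exp (\<i> * of_real ((s - t) * (\<xi> \<bullet> u))) - 1))"
        by (simp add: algebra_simps exp_diff exp_add)
      also have "norm \<dots> \<le> \<bar>s - t\<bar> * (norm \<xi>)\<^sup>2 * (norm u)\<^sup>2"
        unfolding norm_mult[of "exp _"] using norm_levy_exponent_deriv_integrand[of \<xi> u "s - t"]
        by (simp del: of_real_mult of_real_diff)
      finally show "norm (\<i> * of_real (\<xi> \<bullet> u) * (exp (\<i> * of_real (s * (\<xi> \<bullet> u))) - 1) -
          \<i> * of_real (\<xi> \<bullet> u) * (exp (\<i> * of_real (t * (\<xi> \<bullet> u))) - 1)) \<le> \<bar>s - t\<bar> * (norm \<xi>)\<^sup>2 * (norm u)\<^sup>2" .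
    qed (use i integrable_levy_exponent_deriv in auto)
    finally show ?thesis by (simp add: dist_norm C_def mult_ac)
  qed
  then have "C-lipschitz_on UNIV (levy_exponent_deriv \<nu> \<xi>)"
    using C0 by (auto intro!: lipschitz_onI)
  then show ?thesis by (rule lipschitz_on_continuous_on)
qed

end

text \<open>Centering enters here: the derivative at 0 is i times the mean of <\<xi>;X>. It serves
  to identify the drift.\<close>

lemma charfun_has_derivative_0:
  assumes M: "borel_prob M" and 2: "finite_second_moment M" and c: "centered M"
  shows "((\<lambda>s. charfun M (s *\<^sub>R \<xi>)) has_vector_derivative 0) (at 0)"
proof -
  interpret prob_space M using M by (simp add: borel_prob_def)
  have [measurable_cong]: "sets M = sets borel" using M by (simp add: borel_prob_def)
  have 1: "integrable M (\<lambda>x. x)" "(LINT x|M. x) = 0" using c by (auto simp: centered_def)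
  have "((\<lambda>s. LINT x|M. exp (\<i> * of_real (s * (\<xi> \<bullet> x)))) has_vector_derivative
     (LINT x|M. \<i> * of_real (\<xi> \<bullet> x) * exp (\<i> * of_real (0 * (\<xi> \<bullet> x))))) (at 0)"
  proof (rule has_vector_derivative_integral_quadratic[where g="\<lambda>u. (norm \<xi>)\<^sup>2 * (norm u)\<^sup>2"])
    fix h u
    show "norm (exp (\<i> * of_real ((0 + h) * (\<xi> \<bullet> u))) - exp (\<i> * of_real (0 * (\<xi> \<bullet> u)))
      - h *\<^sub>R (\<i> * of_real (\<xi> \<bullet> u) * exp (\<i> * of_real (0 * (\<xi> \<bullet> u))))) \<le> h\<^sup>2 * ((norm \<xi>)\<^sup>2 * (norm u)\<^sup>2)"
      by (rule order_trans[OF iexp_increment_bound]) (intro mult_left_mono inner_sq_le, auto)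
    show "integrable M (\<lambda>x. exp (\<i> * of_real (t * (\<xi> \<bullet> x))))" for t
      by (rule integrable_const_bound[of _ 1]) (auto simp del: of_real_mult)
  qed (use 1 2 in \<open>auto simp: finite_second_moment_def intro!: integrable_of_real\<close>)
  moreover have "(LINT x|M. \<i> * of_real (\<xi> \<bullet> x) * exp (\<i> * of_real (0 * (\<xi> \<bullet> x)))) = 0"
    using 1 by simp
  ultimately show ?thesis by (simp add: charfun_def)
qed

text \<open>Removing the truncation costs a linear term \<open>\<i> * s * \<beta>\<close> in the
  exponent. The fully compensated part has zero derivative at s = 0, and so has the characteristic
  function; comparing derivatives gives \<beta> = 0 without any choice of complex logarithm.\<close>

lemma charfun_levy_exponent:
  assumes ID: "infinitely_divisible_law M b (\<lambda>_. 0) \<nu>" and 2: "finite_second_moment M" and c: "centered M"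
  shows "charfun M (s *\<^sub>R \<xi>) = exp (levy_exponent \<nu> \<xi> s)"
proof -
  have M: "borel_prob M" and L: "levy_measure \<nu>"
    and cf: "charfun M \<xi> = exp (\<i> * of_real (b \<bullet> \<xi>) + (LINT u|\<nu>. levy_kernel \<xi> u))" for \<xi>
    using ID by (auto simp: infinitely_divisible_law_def levy_kernel_def)
  have S[measurable_cong]: "sets \<nu> = sets borel" using L by (simp add: levy_measure_def)
  note i = levy_second_moment[OF ID 2]
  \<comment> \<open>The <\<xi>;.>-component of the mean, read off the triplet: drift plus the jumps
    outside the ball.\<close>
  define \<beta> where "\<beta> = b \<bullet> \<xi> + (LINT u|\<nu>. (\<xi> \<bullet> u) * indicator (- cball 0 1) u)"
  have it: "integrable \<nu> (\<lambda>u. (\<xi> \<bullet> u) * indicator (- cball 0 1) u)"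
  proof (rule integrable_levy_quadratic[OF S i, where C="norm \<xi>"])
    fix u
    have "\<bar>\<xi> \<bullet> u\<bar> \<le> norm \<xi> * norm u" by (rule Cauchy_Schwarz_ineq2)
    also have "1 < norm u \<Longrightarrow> \<dots> \<le> norm \<xi> * (norm u)\<^sup>2"
      by (intro mult_left_mono self_le_power) auto
    finally show "norm ((\<xi> \<bullet> u) * indicator (- cball 0 1) u) \<le> norm \<xi> * (norm u)\<^sup>2"
      by (auto simp: indicator_def)
  qed measurable
  have e: "charfun M (s *\<^sub>R \<xi>) = exp (\<i> * of_real (s * \<beta>) + levy_exponent \<nu> \<xi> s)" for s
  proof -
    have "(LINT u|\<nu>. levy_kernel (s *\<^sub>R \<xi>) u)
      = (LINT u|\<nu>. (exp (\<i> * of_real (s * (\<xi> \<bullet> u))) - 1 - \<i> * of_real (s * (\<xi> \<bullet> u)))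
           + of_real ((\<xi> \<bullet> u) * indicator (- cball 0 1) u) * (\<i> * of_real s))"
      by (intro Bochner_Integration.integral_cong refl) (auto simp: levy_kernel_def indicator_def)
    also have "\<dots> = levy_exponent \<nu> \<xi> s + of_real (LINT u|\<nu>. (\<xi> \<bullet> u) * indicator (- cball 0 1) u) * (\<i> * of_real s)"
      unfolding levy_exponent_def
      using integrable_levy_exponent[OF S i, of s \<xi>] it
      by (subst Bochner_Integration.integral_add) (auto simp del: of_real_mult intro!: integrable_of_real)
    finally show ?thesis by (simp add: cf \<beta>_def algebra_simps)
  qed
  have "((\<lambda>s. exp (\<i> * of_real (s * \<beta>) + levy_exponent \<nu> \<xi> s)) has_vector_derivative
     (\<i> * of_real \<beta> + levy_exponent_deriv \<nu> \<xi> 0) * exp (\<i> * of_real (0 * \<beta>) + levy_exponent \<nu> \<xi> 0)) (at 0)"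
    by (rule has_vector_derivative_eq_rhs, rule field_vector_diff_chain_at[unfolded o_def],
      (rule derivative_eq_intros levy_exponent_has_derivative[OF S i] refl | simp)+)
  then have "\<i> * of_real \<beta> = (0::complex)"
    using charfun_has_derivative_0[OF M 2 c, of \<xi>] vector_derivative_unique_at
    unfolding e by (fastforce simp: levy_exponent_deriv_def levy_exponent_def)
  then show ?thesis by (simp add: e)
qed

section \<open>The laws of the remainders form a kernel\<close>

locale stein_setup =
  fixes M \<nu> :: "'a::euclidean_space measure" and R :: "real \<Rightarrow> 'a measure"
  assumes prob_M: "prob_space M" and sets_M [simp, measurable_cong]: "sets M = sets borel"
    and sets_\<nu> [simp, measurable_cong]: "sets \<nu> = sets borel"
    and sigma_finite_\<nu>: "sigma_finite_measure \<nu>"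
    and sq_\<nu>: "integrable \<nu> (\<lambda>u. (norm u)\<^sup>2)"
    and charfun_M: "charfun M (s *\<^sub>R \<xi>) = exp (levy_exponent \<nu> \<xi> s)"
    and R: "0 < s \<Longrightarrow> s < 1 \<Longrightarrow> borel_prob (R s)"
    and charfun_R: "0 < s \<Longrightarrow> s < 1 \<Longrightarrow> charfun (R s) \<xi> = charfun M \<xi> / charfun M (s *\<^sub>R \<xi>)"
begin

sublocale M: prob_space M by (rule prob_M)
sublocale \<nu>: sigma_finite_measure \<nu> by (rule sigma_finite_\<nu>)
sublocale G: prob_space "gauss_measure :: 'a measure" by (rule prob_space_gauss)

lemma space_M [simp]: "space M = UNIV" by (simp add: sets_eq_imp_space_eq[OF sets_M])
lemma space_\<nu> [simp]: "space \<nu> = UNIV" by (simp add: sets_eq_imp_space_eq[OF sets_\<nu>])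

text \<open>\<open>K s\<close> is the law of $X_s$, extended by a point mass to all \<open>s\<close>, and \<open>\<kappa>\<close> below is the law of
  $(s, X_s)$ for $s$ uniform on $(0,1)$. Only the characteristic functions of the \<open>K s\<close> are given,
  so measurability in \<open>s\<close> has to be recovered by Fourier inversion.\<close>

definition K :: "real \<Rightarrow> 'a measure" where
  "K s = (if 0 < s \<and> s < 1 then R s else return borel 0)"

lemma prob_K: "prob_space (K s)"
  using R[of s] by (auto simp: K_def borel_prob_def intro!: prob_space_return)

lemma sets_K [simp, measurable_cong]: "sets (K s) = sets borel"
  using R[of s] by (auto simp: K_def borel_prob_def)

lemma space_K [simp]: "space (K s) = UNIV"
  by (simp add: sets_eq_imp_space_eq[OF sets_K])

lemma charfun_K: "charfun (K s) \<xi> = (if 0 < s \<and> s < 1 then charfun M \<xi> / charfun M (s *\<^sub>R \<xi>) else 1)"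
  using charfun_R[of s \<xi>] by (auto simp: K_def charfun_def integral_return)

lemma charfun_M_measurable [measurable]: "charfun M \<in> borel_measurable borel"
  unfolding charfun_def[abs_def] by measurable

lemma charfun_K_measurable [measurable]:
  assumes [measurable]: "f \<in> borel_measurable N" "g \<in> borel_measurable N"
  shows "(\<lambda>x. charfun (K (f x)) (g x)) \<in> borel_measurable N"
  unfolding charfun_K by measurable

lemma norm_charfun_K: "norm (charfun (K s) \<xi>) \<le> 1"
proof -
  interpret K: prob_space "K s" by (rule prob_K)
  show ?thesis
    unfolding charfun_def
    by (rule order_trans[OF integral_norm_bound]) (simp add: K.prob_space[simplified])
qed

text \<open>A Gaussian smoothing of \<open>f\<close> integrates under \<open>K s\<close> to a
  Gaussian average of \<open>charfun (K s)\<close>, which is an explicit quotient and hence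
  measurable in \<open>s\<close>. Letting the width 1/(n+1) tend to 0 recovers
  \<open>f\<close>.\<close>

lemma K_integral_measurable:
  fixes f :: "'a \<Rightarrow> complex"
  assumes f: "continuous_on UNIV f" and i: "integrable lborel f" and B: "\<And>x. norm (f x) \<le> B"
  shows "(\<lambda>s. LINT z|K s. f z) \<in> borel_measurable borel"
proof -
  have [measurable]: "f \<in> borel_measurable borel"
    using f by (rule borel_measurable_continuous_onI)
  define F where "F n z = (LINT w|gauss_measure. f (z + (1 / real (Suc n)) *\<^sub>R w))" for n z
  have [measurable]: "F n \<in> borel_measurable borel" for n
    unfolding F_def by measurable
  have FB: "norm (F n z) \<le> B" for n z
    unfolding F_def
    by (rule order_trans[OF Bochner_Integration.integral_norm_bound_integral[where g="\<lambda>_. B"]])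
      (use B in \<open>auto intro!: G.integrable_const_bound[of _ B] simp: G.prob_space[simplified]\<close>)
  show ?thesis
  proof (rule borel_measurable_LIMSEQ_metric)
    fix n
    let ?k = "real (Suc n)"
    obtain C where C: "0 \<le> C" "\<And>v. norm (gauss_weight ?k f v) \<le> C"
      using gauss_weight_bound[OF i, of ?k] by auto
    have "(LINT z|K s. F n z) = (LINT v|gauss_measure. gauss_weight ?k f v * charfun (K s) (?k *\<^sub>R v))" for s
    proof -
      interpret K: prob_space "K s" by (rule prob_K)
      have "(LINT z|K s. F n z) =
        (LINT z|K s. LINT v|gauss_measure. gauss_weight ?k f v * exp (\<i> * of_real (?k * (v \<bullet> z))))"
        unfolding F_def by (subst gauss_smoothing[OF i]) auto
      also have "\<dots> = (LINT v|gauss_measure. LINT z|K s. gauss_weight ?k f v * exp (\<i> * of_real (?k * (v \<bullet> z))))"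
        by (rule Fubini_dominated[where g="\<lambda>_. C" and h="\<lambda>_. 1"])
          (use C in \<open>auto simp: norm_mult K.sigma_finite_measure_axioms G.sigma_finite_measure_axioms
            simp del: of_real_mult of_nat_Suc\<close>)
      finally show ?thesis by (simp add: charfun_def del: of_nat_Suc)
    qed
    then show "(\<lambda>s. LINT z|K s. F n z) \<in> borel_measurable borel"
      by simp
  next
    fix s
    interpret K: prob_space "K s" by (rule prob_K)
    show "(\<lambda>n. LINT z|K s. F n z) \<longlonglongrightarrow> (LINT z|K s. f z)"
      by (rule integral_dominated_convergence[where w="\<lambda>_. B"])
        (use FB gauss_smoothing_tendsto[OF f B] in \<open>auto simp: F_def simp del: of_nat_Suc\<close>)
  qed
qed

text \<open>Open boxes form an intersection-stable generator, and the indicator of a box is a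
  pointwise limit of continuous functions supported in it, to which
  \<open>K_integral_measurable\<close> applies.\<close>

lemma K_prob_algebra: "K \<in> borel \<rightarrow>\<^sub>M prob_algebra borel"
proof (rule measurable_prob_algebra_generated[where G="range (\<lambda>(a, b). box a b)" and \<Omega>=UNIV])
  show "sets borel = sigma_sets UNIV (range (\<lambda>(a::'a, b). box a b))"
    by (simp add: borel_eq_box)
  show "Int_stable (range (\<lambda>(a::'a, b). box a b))"
    by (auto simp: Int_stable_def box_Int_box)
  fix A assume "A \<in> range (\<lambda>(a::'a, b). box a b)"
  then obtain a b where A: "A = box a b" by auto
  \<comment> \<open>\<open>infdist\<close> to the empty set is 0 by convention, which would make
    every \<open>f n\<close> vanish; boundedness of the box excludes this.\<close>
  have ne: "- A \<noteq> {}" using A not_bounded_UNIV[where 'a='a] bounded_box[of a b]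
    by (metis Compl_empty_eq double_complement)
  define f where "f n x = min 1 (real n * infdist x (- A))" for n x
  have cf: "continuous_on UNIV (f n)" for n
    unfolding f_def by (intro continuous_intros)
  then have [measurable]: "f n \<in> borel_measurable borel" for n
    by (rule borel_measurable_continuous_onI)
  have [measurable]: "A \<in> sets borel" using A by simp
  have f01: "0 \<le> f n x" "f n x \<le> indicator A x" for n x
    by (auto simp: f_def infdist_nonneg indicator_def)
  have f01': "f n x \<le> 1" for n x by (simp add: f_def)
  have lim: "(\<lambda>n. f n x) \<longlonglongrightarrow> indicator A x" for x
  proof (cases "x \<in> A")
    case True
    have "closed (- A)" using A by (simp add: open_box closed_Compl)
    then have d: "0 < infdist x (- A)"
      using True ne in_closed_iff_infdist_zero[of "- A" x] infdist_nonneg[of x "- A"] by auto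
    obtain n0 where n0: "1 / infdist x (- A) < real n0" using reals_Archimedean2 by blast
    have "\<forall>\<^sub>F n in sequentially. f n x = 1"
    proof (intro eventually_sequentiallyI[of n0])
      fix n assume "n0 \<le> n"
      then have "1 / infdist x (- A) \<le> real n" using n0 by linarith
      then show "f n x = 1" using d by (simp add: f_def field_simps)
    qed
    then show ?thesis using True by (auto intro: tendsto_eventually)
  next
    case False
    then have "f n x = 0" for n by (simp add: f_def)
    with False show ?thesis by simp
  qed
  have int: "(\<lambda>s. LINT z|K s. complex_of_real (f n z)) \<in> borel_measurable borel" for n
  proof (rule K_integral_measurable[where B=1])
    show "norm (complex_of_real (f n x)) \<le> 1" for x
      using f01(1)[of n x] f01'[of n x] by simp
    have "integrable lborel (indicator A :: 'a \<Rightarrow> real)"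
      using A emeasure_lborel_box_finite[of a b] by (intro integrable_real_indicator) auto
    then have "integrable lborel (f n)"
      by (rule Bochner_Integration.integrable_bound) (use f01 in auto)
    then show "integrable lborel (\<lambda>x. complex_of_real (f n x))"
      by (rule integrable_of_real)
  qed (intro continuous_on_of_real cf)
  have "(\<lambda>s. measure (K s) A) \<in> borel_measurable borel"
  proof (rule borel_measurable_LIMSEQ_metric)
    show "(\<lambda>s. Re (LINT z|K s. complex_of_real (f n z))) \<in> borel_measurable borel" for n
      using int by measurable
    fix s
    interpret K: prob_space "K s" by (rule prob_K)
    have "(\<lambda>n. LINT z|K s. f n z) \<longlonglongrightarrow> (LINT z|K s. indicator A z)"
      by (rule integral_dominated_convergence[where w="\<lambda>_. 1"])
        (use f01 f01' lim in auto)
    then show "(\<lambda>n. Re (LINT z|K s. complex_of_real (f n z))) \<longlonglongrightarrow> measure (K s) A"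
      by simp
  qed
  then show "(\<lambda>s. emeasure (K s) A) \<in> borel_measurable borel"
    using finite_measure.emeasure_eq_measure[OF prob_space.finite_measure[OF prob_K]] by simp
qed (use prob_K in auto)

lemma K_subprob_algebra [measurable]: "K \<in> borel \<rightarrow>\<^sub>M subprob_algebra borel"
  using K_prob_algebra measurable_prob_algebraD by blast

section \<open>The joint law of the uniform scale and the remainder\<close>

definition U :: "real measure" where
  "U = density lborel (indicator {0<..<1})"

lemma sets_U [simp, measurable_cong]: "sets U = sets borel"
  by (simp add: U_def)

lemma space_U [simp]: "space U = UNIV"
  by (simp add: U_def)

lemma prob_U: "prob_space U"
  by standard (simp add: U_def emeasure_density)

sublocale U: prob_space U by (rule prob_U)

lemma AE_U: "AE s in U. 0 < s \<and> s < 1"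
  unfolding U_def by (subst AE_density) (auto simp: indicator_def)

definition \<kappa> :: "(real \<times> 'a) measure" where
  "\<kappa> = U \<bind> (\<lambda>s. distr (K s) (borel \<Otimes>\<^sub>M borel) (Pair s))"

lemma kernel_measurable [measurable]:
  "(\<lambda>s. distr (K s) (borel \<Otimes>\<^sub>M borel) (Pair s)) \<in> U \<rightarrow>\<^sub>M subprob_algebra (borel \<Otimes>\<^sub>M borel)"
  by (rule measurable_distr2[where M=borel]) measurable

lemma sets_\<kappa> [simp, measurable_cong]: "sets \<kappa> = sets (borel \<Otimes>\<^sub>M borel)"
  unfolding \<kappa>_def by (rule sets_bind) auto

lemma space_\<kappa> [simp]: "space \<kappa> = UNIV"
  by (simp add: sets_eq_imp_space_eq[OF sets_\<kappa>] space_pair_measure)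

lemma nn_integral_\<kappa>:
  assumes [measurable]: "f \<in> borel_measurable (borel \<Otimes>\<^sub>M borel)"
  shows "(\<integral>\<^sup>+p. f p \<partial>\<kappa>) = (\<integral>\<^sup>+s. \<integral>\<^sup>+z. f (s, z) \<partial>K s \<partial>U)"
  unfolding \<kappa>_def
  by (subst nn_integral_bind[OF _ kernel_measurable]) (simp_all add: nn_integral_distr)

lemma prob_\<kappa>: "prob_space \<kappa>"
proof
  have "emeasure (K s) UNIV = 1" for s
    using prob_space.emeasure_space_1[OF prob_K, of s] by simp
  then show "emeasure \<kappa> (space \<kappa>) = 1"
    using nn_integral_\<kappa>[of "\<lambda>_. 1"] U.emeasure_space_1 by simp
qed

sublocale \<kappa>: prob_space \<kappa> by (rule prob_\<kappa>)

lemma AE_\<kappa>: "AE p in \<kappa>. 0 < fst p \<and> fst p < 1"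
  unfolding \<kappa>_def
  by (subst AE_bind[OF kernel_measurable]) (use AE_U in \<open>auto simp: AE_distr_iff\<close>)

lemma nn_integral_fst_\<kappa>: "(\<integral>\<^sup>+p. ennreal (fst p) \<partial>\<kappa>) = ennreal (1/2)"
proof -
  have "emeasure (K s) UNIV = 1" for s
    using prob_space.emeasure_space_1[OF prob_K, of s] by simp
  then have "(\<integral>\<^sup>+p. ennreal (fst p) \<partial>\<kappa>) = (\<integral>\<^sup>+s. ennreal s \<partial>U)"
    by (subst nn_integral_\<kappa>) auto
  also have "\<dots> = (\<integral>\<^sup>+s. ennreal s * indicator {0..1} s \<partial>lborel)"
    unfolding U_def
    by (subst nn_integral_density, simp, simp, rule nn_integral_cong_AE)
      (use AE_lborel_singleton[of 0] AE_lborel_singleton[of 1] in \<open>eventually_elim, auto simp: indicator_def\<close>)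
  also have "\<dots> = ennreal (1\<^sup>2 / 2 - 0\<^sup>2 / 2)"
    by (rule nn_integral_FTC_Icc) (auto intro!: derivative_eq_intros)
  finally show ?thesis by simp
qed

lemma integral_\<kappa>:
  fixes f :: "real \<times> 'a \<Rightarrow> complex"
  assumes [measurable]: "f \<in> borel_measurable (borel \<Otimes>\<^sub>M borel)" and B: "\<And>p. norm (f p) \<le> B"
  shows "(LINT p|\<kappa>. f p) = (LINT s|U. LINT z|K s. f (s, z))"
proof -
  have real: "(LINT p|\<kappa>. g p) = (LINT s|U. LINT z|K s. g (s, z))"
    if [measurable]: "g \<in> borel_measurable (borel \<Otimes>\<^sub>M borel)" and "\<And>p. \<bar>g p\<bar> \<le> B" for g :: "real \<times> 'a \<Rightarrow> real"
  proof -
    have "emeasure (distr (K s) (borel \<Otimes>\<^sub>M borel) (Pair s)) UNIV \<le> ennreal 1" for s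
      using prob_space.emeasure_space_1[OF prob_K, of s]
        sets.top[of "borel \<Otimes>\<^sub>M borel :: (real \<times> 'a) measure"]
      by (subst emeasure_distr) (auto simp: space_pair_measure)
    then show ?thesis
      unfolding \<kappa>_def using that
      by (subst integral_bind[OF _ _ kernel_measurable, where B=B and B'=1])
        (auto simp: integral_distr space_pair_measure U.finite_measure_axioms)
  qed
  have iK: "integrable (K s) (\<lambda>z. f (s, z))" for s
  proof -
    interpret K: prob_space "K s" by (rule prob_K)
    show ?thesis by (rule K.integrable_const_bound[of _ B]) (use B in auto)
  qed
  have nb: "norm (LINT z|K s. f (s, z)) \<le> B" for s
  proof -
    interpret K: prob_space "K s" by (rule prob_K)
    show ?thesis
      by (rule order_trans[OF Bochner_Integration.integral_norm_bound_integral[where g="\<lambda>_. B"]])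
        (use B iK K.prob_space in auto)
  qed
  have mU: "(\<lambda>s. LINT z|K s. f (s, z)) \<in> borel_measurable U"
  proof -
    have "(\<lambda>s. integral\<^sup>L (distr (K s) (borel \<Otimes>\<^sub>M borel) (Pair s)) f) \<in> borel_measurable U"
      by (rule measurable_compose[OF kernel_measurable integral_measurable_subprob_algebra]) fact
    then show ?thesis by (simp add: integral_distr)
  qed
  have iU: "integrable U (\<lambda>s. LINT z|K s. f (s, z))"
    by (rule U.integrable_const_bound[of _ B]) (use nb mU in auto)
  have i\<kappa>: "integrable \<kappa> f"
    by (rule \<kappa>.integrable_const_bound[of _ B]) (use B in auto)
  have 1: "Re (LINT p|\<kappa>. f p) = Re (LINT s|U. LINT z|K s. f (s, z))"
    unfolding integral_Re[OF i\<kappa>, symmetric] integral_Re[OF iU, symmetric] integral_Re[OF iK, symmetric]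
    by (rule real) (auto intro: order_trans[OF abs_Re_le_cmod B])
  have 2: "Im (LINT p|\<kappa>. f p) = Im (LINT s|U. LINT z|K s. f (s, z))"
    unfolding integral_Im[OF i\<kappa>, symmetric] integral_Im[OF iU, symmetric] integral_Im[OF iK, symmetric]
    by (rule real) (auto intro: order_trans[OF abs_Im_le_cmod B])
  from 1 2 show ?thesis by (rule complex_eqI)
qed

section \<open>The Stein equation for exponentials and its closure properties\<close>

text \<open>The Stein equation for a pair of \<open>h\<close> and its derivative \<open>H x u\<close> at \<open>x\<close> in direction \<open>u\<close>.\<close>

definition stein_pair :: "('a \<Rightarrow> complex) \<Rightarrow> ('a \<Rightarrow> 'a \<Rightarrow> complex) \<Rightarrow> bool" where
  "stein_pair h H \<longleftrightarrow> (\<forall>x. h x - (LINT z|M. h z) =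
     (LINT p|\<kappa>. H (fst p *\<^sub>R x + snd p) x)
     - (LINT u|\<nu>. LINT p|\<kappa>. H (fst p *\<^sub>R (x + u) + snd p) u - H (fst p *\<^sub>R x + snd p) u))"

text \<open>For the exponential of frequency \<xi>, the function \<open>G\<close> of the overview is
  i \<xi> times this scalar.\<close>

definition \<Gamma> :: "'a \<Rightarrow> 'a \<Rightarrow> complex" where
  "\<Gamma> \<xi> x = (LINT p|\<kappa>. exp (\<i> * of_real (\<xi> \<bullet> (fst p *\<^sub>R x + snd p))))"

lemma \<Gamma>_integrable: "integrable \<kappa> (\<lambda>p. exp (\<i> * of_real (\<xi> \<bullet> (fst p *\<^sub>R x + snd p))))"
  by (rule \<kappa>.integrable_const_bound[of _ 1]) auto

lemma \<Gamma>_measurable [measurable]: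
  assumes [measurable]: "f \<in> borel_measurable N" "g \<in> borel_measurable N"
  shows "(\<lambda>x. \<Gamma> (f x) (g x)) \<in> borel_measurable N"
  unfolding \<Gamma>_def by measurable

lemma \<Gamma>_eq: "\<Gamma> \<xi> x = (LINT s|U. exp (\<i> * of_real (s * (\<xi> \<bullet> x))) * charfun (K s) \<xi>)"
proof -
  have "\<Gamma> \<xi> x = (LINT s|U. LINT z|K s. exp (\<i> * of_real (\<xi> \<bullet> (fst (s, z) *\<^sub>R x + snd (s, z)))))"
    unfolding \<Gamma>_def by (rule integral_\<kappa>[where B=1]) auto
  also have "\<dots> = (LINT s|U. exp (\<i> * of_real (s * (\<xi> \<bullet> x))) * charfun (K s) \<xi>)"
    by (simp add: charfun_def inner_add_right distrib_left exp_add)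
  finally show ?thesis .
qed

text \<open>Together with the factor <\<xi>;u> of the Stein equation this makes the integrand
  quadratic both in \<open>u\<close>, for the second moment of \<nu>, and in \<xi>, for that of the
  Gaussian mixing law.\<close>

lemma \<Gamma>_diff: "norm (\<Gamma> \<xi> (x + u) - \<Gamma> \<xi> x) \<le> norm \<xi> * norm u"
proof -
  have "norm (\<Gamma> \<xi> (x + u) - \<Gamma> \<xi> x) =
     norm (LINT p|\<kappa>. exp (\<i> * of_real (\<xi> \<bullet> (fst p *\<^sub>R (x + u) + snd p))) - exp (\<i> * of_real (\<xi> \<bullet> (fst p *\<^sub>R x + snd p))))"
    unfolding \<Gamma>_def using \<Gamma>_integrable by simp
  also have "\<dots> \<le> (LINT p|\<kappa>. norm (exp (\<i> * of_real (\<xi> \<bullet> (fst p *\<^sub>R (x + u) + snd p))) - exp (\<i> * of_real (\<xi> \<bullet> (fst p *\<^sub>R x + snd p)))))"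
    by (rule integral_norm_bound)
  also have "\<dots> \<le> (LINT p|\<kappa>. norm \<xi> * norm u)"
  proof (rule integral_mono_AE)
    show "integrable \<kappa> (\<lambda>p. norm (exp (\<i> * of_real (\<xi> \<bullet> (fst p *\<^sub>R (x + u) + snd p))) - exp (\<i> * of_real (\<xi> \<bullet> (fst p *\<^sub>R x + snd p)))))"
      using \<Gamma>_integrable by (intro integrable_norm Bochner_Integration.integrable_diff)
    show "AE p in \<kappa>. norm (exp (\<i> * of_real (\<xi> \<bullet> (fst p *\<^sub>R (x + u) + snd p))) - exp (\<i> * of_real (\<xi> \<bullet> (fst p *\<^sub>R x + snd p))))
        \<le> norm \<xi> * norm u"
      using AE_\<kappa>
    proof eventually_elim
      case (elim p)
      have "exp (\<i> * of_real (\<xi> \<bullet> (fst p *\<^sub>R (x + u) + snd p))) - exp (\<i> * of_real (\<xi> \<bullet> (fst p *\<^sub>R x + snd p)))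
         = exp (\<i> * of_real (\<xi> \<bullet> (fst p *\<^sub>R x + snd p))) * (exp (\<i> * of_real (fst p * (\<xi> \<bullet> u))) - 1)"
        by (simp add: algebra_simps inner_add_right exp_add)
      also have "norm \<dots> \<le> \<bar>fst p * (\<xi> \<bullet> u)\<bar>"
        unfolding norm_mult using iexp_bound1[of "fst p * (\<xi> \<bullet> u)"] by (simp del: of_real_mult)
      also have "\<dots> = fst p * \<bar>\<xi> \<bullet> u\<bar>" using elim by (simp add: abs_mult)
      also have "\<dots> \<le> 1 * (norm \<xi> * norm u)"
        using elim by (intro mult_mono Cauchy_Schwarz_ineq2) auto
      finally show ?case by simp
    qed
  qed auto
  finally show ?thesis by (simp add: \<kappa>.prob_space[simplified])
qed

text \<open>On (0,1), \<open>charfun M \<xi> * E s\<close> is the integrand of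
  \<open>\<Gamma>_eq\<close>, and it runs from \<open>charfun M \<xi>\<close> at 0 to the
  exponential at 1. Of the two terms of its derivative, the one with <\<xi>;x> gives the first term
  on the right. The other contains \<open>levy_exponent_deriv\<close>, an integral of
  e^{is<\<xi>;u>} - 1; multiplied by e^{is<\<xi>;x>}, this is the increment from \<open>x\<close> to
  \<open>x + u\<close>.\<close>

lemma stein_exponential:
  "exp (\<i> * of_real (\<xi> \<bullet> x)) - charfun M \<xi> =
     \<i> * of_real (\<xi> \<bullet> x) * \<Gamma> \<xi> x - (LINT u|\<nu>. \<i> * of_real (\<xi> \<bullet> u) * (\<Gamma> \<xi> (x + u) - \<Gamma> \<xi> x))"
proof -
  note D = levy_exponent_has_derivative[OF sets_\<nu> sq_\<nu>]
  define E where "E s = exp (\<i> * of_real (s * (\<xi> \<bullet> x)) - levy_exponent \<nu> \<xi> s)" for s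
  define E' where "E' s = (\<i> * of_real (\<xi> \<bullet> x) - levy_exponent_deriv \<nu> \<xi> s) * E s" for s
  have dE: "(E has_vector_derivative E' s) (at s)" for s
    unfolding E_def[abs_def] E'_def
    by (rule has_vector_derivative_eq_rhs, rule field_vector_diff_chain_at[unfolded o_def],
      (rule derivative_eq_intros D refl | simp)+)
  have cE: "continuous_on UNIV E"
    using dE has_vector_derivative_continuous continuous_at_imp_continuous_on by blast
  have cE': "continuous_on UNIV E'"
    unfolding E'_def by (intro continuous_intros cE continuous_levy_exponent_deriv[OF sets_\<nu> sq_\<nu>])
  have K_E: "exp (\<i> * of_real (s * (\<xi> \<bullet> x))) * charfun (K s) \<xi> = charfun M \<xi> * E s" if "0 < s" "s < 1" for s
    using that by (simp add: charfun_K charfun_M E_def exp_diff)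
  have md [measurable]: "levy_exponent_deriv \<nu> \<xi> \<in> borel_measurable borel"
    by (rule borel_measurable_continuous_onI[OF continuous_levy_exponent_deriv[OF sets_\<nu> sq_\<nu>]])
  have iU1: "integrable U (\<lambda>s. exp (\<i> * of_real (s * (\<xi> \<bullet> y))) * charfun (K s) \<xi>)" for y
    by (rule U.integrable_const_bound[of _ 1]) (auto simp: norm_mult norm_charfun_K simp del: of_real_mult)
  \<comment> \<open>The indicator equals 1 almost everywhere under \<open>U\<close>; it is inserted
    because \<open>Fubini_dominated\<close> asks for a bound at every \<open>s\<close>.\<close>
  have bnd: "norm (\<i> * of_real (\<xi> \<bullet> u) * (exp (\<i> * of_real (s * (\<xi> \<bullet> u))) - 1) * indicator {0<..<1} s) \<le> (norm \<xi>)\<^sup>2 * (norm u)\<^sup>2" for u s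
  proof (cases "0 < s \<and> s < 1")
    case True
    have "norm (\<i> * of_real (\<xi> \<bullet> u) * (exp (\<i> * of_real (s * (\<xi> \<bullet> u))) - 1)) \<le> \<bar>s\<bar> * ((norm \<xi>)\<^sup>2 * (norm u)\<^sup>2)"
      using norm_levy_exponent_deriv_integrand[OF sets_\<nu> sq_\<nu>, of \<xi> u s] by (simp only: mult.assoc)
    also have "\<dots> \<le> 1 * ((norm \<xi>)\<^sup>2 * (norm u)\<^sup>2)"
      using True by (intro mult_right_mono) auto
    finally show ?thesis using True by (simp only: indicator_simps greaterThanLessThan_iff mult_1_right mult_1_left)
  qed (auto simp: indicator_def)
  let ?F = "\<lambda>u s. \<i> * of_real (\<xi> \<bullet> u) * (exp (\<i> * of_real (s * (\<xi> \<bullet> u))) - 1) * indicator {0<..<1} s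
          * (exp (\<i> * of_real (s * (\<xi> \<bullet> x))) * charfun (K s) \<xi>)"
  have "(LINT u|\<nu>. \<i> * of_real (\<xi> \<bullet> u) * (\<Gamma> \<xi> (x + u) - \<Gamma> \<xi> x)) = (LINT u|\<nu>. LINT s|U. ?F u s)"
  proof (intro Bochner_Integration.integral_cong refl)
    fix u
    have "\<i> * of_real (\<xi> \<bullet> u) * (\<Gamma> \<xi> (x + u) - \<Gamma> \<xi> x) =
      (LINT s|U. \<i> * of_real (\<xi> \<bullet> u) * (exp (\<i> * of_real (s * (\<xi> \<bullet> (x + u)))) * charfun (K s) \<xi> - exp (\<i> * of_real (s * (\<xi> \<bullet> x))) * charfun (K s) \<xi>))"
      unfolding \<Gamma>_eq using iU1 by simp
    also have "\<dots> = (LINT s|U. ?F u s)"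
      by (rule integral_cong_AE, measurable, use AE_U in eventually_elim)
        (simp add: indicator_def algebra_simps inner_add_right exp_add)
    finally show "\<i> * of_real (\<xi> \<bullet> u) * (\<Gamma> \<xi> (x + u) - \<Gamma> \<xi> x) = (LINT s|U. ?F u s)" .
  qed
  also have "\<dots> = (LINT s|U. LINT u|\<nu>. ?F u s)"
  proof (rule Fubini_dominated[where g="\<lambda>u. (norm \<xi>)\<^sup>2 * (norm u)\<^sup>2" and h="\<lambda>_. 1"])
    fix u s
    have "norm (?F u s) \<le> ((norm \<xi>)\<^sup>2 * (norm u)\<^sup>2) * (1 * 1)"
      unfolding norm_mult[of "_ * indicator _ _"] norm_mult[of "exp _"]
      by (intro mult_mono bnd norm_charfun_K) (auto simp del: of_real_mult)
    then show "norm (?F u s) \<le> (norm \<xi>)\<^sup>2 * (norm u)\<^sup>2 * 1" by simp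
  qed (use sigma_finite_\<nu> sq_\<nu> U.sigma_finite_measure_axioms in auto)
  also have "\<dots> = (LINT s|U. levy_exponent_deriv \<nu> \<xi> s * (exp (\<i> * of_real (s * (\<xi> \<bullet> x))) * charfun (K s) \<xi>))"
    by (rule integral_cong_AE, measurable, use AE_U in eventually_elim)
      (simp add: levy_exponent_deriv_def)
  finally have 1: "(LINT u|\<nu>. \<i> * of_real (\<xi> \<bullet> u) * (\<Gamma> \<xi> (x + u) - \<Gamma> \<xi> x))
    = (LINT s|U. levy_exponent_deriv \<nu> \<xi> s * (exp (\<i> * of_real (s * (\<xi> \<bullet> x))) * charfun (K s) \<xi>))" .
  obtain C where C: "\<And>s. s \<in> {0..1} \<Longrightarrow> norm (levy_exponent_deriv \<nu> \<xi> s) \<le> C"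
    using compact_imp_bounded[OF compact_continuous_image[OF continuous_on_subset[OF continuous_levy_exponent_deriv[OF sets_\<nu> sq_\<nu>, of \<xi>]], of "{0..1}"]]
    unfolding bounded_iff by (metis imageI subset_UNIV compact_Icc)
  have i2: "integrable U (\<lambda>s. levy_exponent_deriv \<nu> \<xi> s * (exp (\<i> * of_real (s * (\<xi> \<bullet> x))) * charfun (K s) \<xi>))"
  proof (rule U.integrable_const_bound[of _ C])
    show "AE s in U. norm (levy_exponent_deriv \<nu> \<xi> s * (exp (\<i> * of_real (s * (\<xi> \<bullet> x))) * charfun (K s) \<xi>)) \<le> C"
      using AE_U
    proof eventually_elim
      case (elim s)
      have "norm (levy_exponent_deriv \<nu> \<xi> s * (exp (\<i> * of_real (s * (\<xi> \<bullet> x))) * charfun (K s) \<xi>)) \<le> C * (1 * 1)"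
        unfolding norm_mult using elim C[of s] order_trans[OF norm_ge_zero C[of s]]
        by (intro mult_mono norm_charfun_K) (auto simp del: of_real_mult)
      then show ?case by simp
    qed
  qed measurable
  have "\<i> * of_real (\<xi> \<bullet> x) * \<Gamma> \<xi> x - (LINT u|\<nu>. \<i> * of_real (\<xi> \<bullet> u) * (\<Gamma> \<xi> (x + u) - \<Gamma> \<xi> x))
    = (LINT s|U. \<i> * of_real (\<xi> \<bullet> x) * (exp (\<i> * of_real (s * (\<xi> \<bullet> x))) * charfun (K s) \<xi>) -
         levy_exponent_deriv \<nu> \<xi> s * (exp (\<i> * of_real (s * (\<xi> \<bullet> x))) * charfun (K s) \<xi>))"
    using iU1[of x] i2 by (subst 1, subst \<Gamma>_eq) simp
  also have "\<dots> = (LINT s|U. charfun M \<xi> * E' s)"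
    by (rule integral_cong_AE, measurable, use borel_measurable_continuous_onI[OF cE'] in simp, use AE_U in eventually_elim)
      (simp only: K_E E'_def, simp add: algebra_simps)
  also have "\<dots> = (LINT s|lborel. indicator {0<..<1} s *\<^sub>R (charfun M \<xi> * E' s))"
  proof -
    have U: "U = density lborel (\<lambda>s. ennreal (indicator {0<..<1} s))"
      by (simp add: U_def ennreal_indicator)
    show ?thesis
      unfolding U by (rule integral_density) (use borel_measurable_continuous_onI[OF cE'] in auto)
  qed
  also have "\<dots> = (LINT s|lborel. charfun M \<xi> * (indicator {0..1} s *\<^sub>R E' s))"
  proof (rule integral_cong_AE)
    show "AE s in lborel. indicator {0<..<1} s *\<^sub>R (charfun M \<xi> * E' s) = charfun M \<xi> * (indicator {0..1} s *\<^sub>R E' s)"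
      using AE_lborel_singleton[of 0] AE_lborel_singleton[of "1::real"]
      by eventually_elim (auto simp: indicator_def)
  qed (use borel_measurable_continuous_onI[OF cE'] in auto)
  also have "\<dots> = charfun M \<xi> * (E 1 - E 0)"
    by (subst integral_mult_right_zero, subst integral_FTC_Icc[where F=E])
      (auto intro: has_vector_derivative_at_within[OF dE] continuous_on_subset[OF cE'])
  also have "\<dots> = exp (\<i> * of_real (\<xi> \<bullet> x)) - charfun M \<xi>"
    using charfun_M[of 1 \<xi>] by (simp add: E_def levy_exponent_def exp_diff right_diff_distrib)
  finally show ?thesis by simp
qed

text \<open>\<open>stein_exponential\<close> at frequency \<open>k v\<close> is multiplied by
  \<open>W v\<close> and averaged over Gaussian v. What has to be justified is the exchange of this
  average with each of the integrals over \<open>M\<close>, \<open>\<kappa>\<close> and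
  \<nu>.\<close>

lemma stein_pair_mixture:
  fixes W :: "'a \<Rightarrow> complex"
  assumes W[measurable]: "W \<in> borel_measurable borel" and C: "\<And>v. norm (W v) \<le> C" and k: "0 < k"
  shows "stein_pair (\<lambda>x. LINT v|gauss_measure. W v * exp (\<i> * of_real (k * (v \<bullet> x))))
     (\<lambda>x u. LINT v|gauss_measure. \<i> * of_real (k * (v \<bullet> u)) * W v * exp (\<i> * of_real (k * (v \<bullet> x))))"
  unfolding stein_pair_def
proof
  fix x :: 'a
  let ?\<gamma> = "gauss_measure :: 'a measure"
  have C0: "0 \<le> C" using order_trans[OF norm_ge_zero C] .
  have i1: "integrable ?\<gamma> (\<lambda>v. norm v)"
  proof (rule Bochner_Integration.integrable_bound[of _ "\<lambda>v. 1 + (norm v)\<^sup>2"])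
    show "AE v in ?\<gamma>. norm (norm v) \<le> norm (1 + (norm v)\<^sup>2)"
      by (intro AE_I2) (smt (verit) norm_ge_zero real_norm_def self_le_power power2_eq_square zero_le_power2 one_le_power pos2 le_numeral_extra(4))
  qed (use integrable_gauss_sq in auto)
  have A: "(LINT p|\<kappa>. LINT v|?\<gamma>. \<i> * of_real (k * (v \<bullet> u)) * W v * exp (\<i> * of_real (k * (v \<bullet> (fst p *\<^sub>R y + snd p)))))
     = (LINT v|?\<gamma>. W v * (\<i> * of_real ((k *\<^sub>R v) \<bullet> u) * \<Gamma> (k *\<^sub>R v) y))"
    and Ai: "integrable \<kappa> (\<lambda>p. LINT v|?\<gamma>. \<i> * of_real (k * (v \<bullet> u)) * W v * exp (\<i> * of_real (k * (v \<bullet> (fst p *\<^sub>R y + snd p)))))"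
    and Aj: "integrable ?\<gamma> (\<lambda>v. W v * (\<i> * of_real ((k *\<^sub>R v) \<bullet> u) * \<Gamma> (k *\<^sub>R v) y))" for u y
  proof -
    let ?f = "\<lambda>p v. \<i> * of_real (k * (v \<bullet> u)) * W v * exp (\<i> * of_real (k * (v \<bullet> (fst p *\<^sub>R y + snd p))))"
    have m: "case_prod ?f \<in> borel_measurable (\<kappa> \<Otimes>\<^sub>M ?\<gamma>)" by measurable
    have b: "norm (?f p v) \<le> 1 * (C * k * norm u * norm v)" for p v
    proof -
      have "norm (?f p v) = k * \<bar>v \<bullet> u\<bar> * norm (W v)"
        using k by (simp add: norm_mult abs_mult del: of_real_mult)
      also have "\<dots> \<le> k * (norm v * norm u) * C"
        using k C0 C by (intro mult_mono Cauchy_Schwarz_ineq2) auto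
      finally show ?thesis by (simp add: mult_ac)
    qed
    have "integrable \<kappa> (\<lambda>_. 1 :: real)" "integrable ?\<gamma> (\<lambda>v. C * k * norm u * norm v)"
      using i1 by auto
    note F = Fubini_dominated[OF \<kappa>.sigma_finite_measure_axioms G.sigma_finite_measure_axioms m b this]
    have e: "(LINT p|\<kappa>. ?f p v) = W v * (\<i> * of_real ((k *\<^sub>R v) \<bullet> u) * \<Gamma> (k *\<^sub>R v) y)" for v
      by (simp add: \<Gamma>_def inner_add_right algebra_simps del: of_real_mult of_real_add)
    show "(LINT p|\<kappa>. LINT v|?\<gamma>. ?f p v) = (LINT v|?\<gamma>. W v * (\<i> * of_real ((k *\<^sub>R v) \<bullet> u) * \<Gamma> (k *\<^sub>R v) y))"
      using F(2) unfolding e .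
    show "integrable \<kappa> (\<lambda>p. LINT v|?\<gamma>. ?f p v)"
      by (rule F(3))
    show "integrable ?\<gamma> (\<lambda>v. W v * (\<i> * of_real ((k *\<^sub>R v) \<bullet> u) * \<Gamma> (k *\<^sub>R v) y))"
      using F(4) unfolding e .
  qed
  have iW: "integrable ?\<gamma> (\<lambda>v. W v * exp (\<i> * of_real (k * (v \<bullet> y))))" for y
    by (rule G.integrable_const_bound[of _ C]) (use C in \<open>auto simp: norm_mult simp del: of_real_mult\<close>)
  have iW': "integrable ?\<gamma> (\<lambda>v. W v * charfun M (k *\<^sub>R v))"
  proof (rule G.integrable_const_bound[of _ C])
    have "norm (charfun M \<xi>) \<le> 1" for \<xi>
      unfolding charfun_def
      by (rule order_trans[OF integral_norm_bound]) (simp add: M.prob_space[simplified])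
    then show "AE v in ?\<gamma>. norm (W v * charfun M (k *\<^sub>R v)) \<le> C"
      using mult_mono[OF C \<open>\<And>\<xi>. norm (charfun M \<xi>) \<le> 1\<close> C0 norm_ge_zero]
      by (intro AE_I2) (simp add: norm_mult)
  qed measurable
  have B: "(LINT z|M. LINT v|?\<gamma>. W v * exp (\<i> * of_real (k * (v \<bullet> z)))) = (LINT v|?\<gamma>. W v * charfun M (k *\<^sub>R v))"
  proof -
    have "(LINT z|M. LINT v|?\<gamma>. W v * exp (\<i> * of_real (k * (v \<bullet> z)))) = (LINT v|?\<gamma>. LINT z|M. W v * exp (\<i> * of_real (k * (v \<bullet> z))))"
      by (rule Fubini_dominated[where g="\<lambda>_. C" and h="\<lambda>_. 1"])
        (use C in \<open>auto simp: norm_mult M.sigma_finite_measure_axioms G.sigma_finite_measure_axioms simp del: of_real_mult\<close>)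
    then show ?thesis by (simp add: charfun_def)
  qed
  let ?g = "\<lambda>u v. W v * (\<i> * of_real ((k *\<^sub>R v) \<bullet> u) * (\<Gamma> (k *\<^sub>R v) (x + u) - \<Gamma> (k *\<^sub>R v) x))"
  have D: "(LINT u|\<nu>. LINT p|\<kappa>.
      (LINT v|?\<gamma>. \<i> * of_real (k * (v \<bullet> u)) * W v * exp (\<i> * of_real (k * (v \<bullet> (fst p *\<^sub>R (x + u) + snd p)))))
      - (LINT v|?\<gamma>. \<i> * of_real (k * (v \<bullet> u)) * W v * exp (\<i> * of_real (k * (v \<bullet> (fst p *\<^sub>R x + snd p))))))
    = (LINT u|\<nu>. LINT v|?\<gamma>. ?g u v)"
  proof (intro Bochner_Integration.integral_cong refl)
    fix u
    show "(LINT p|\<kappa>.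
      (LINT v|?\<gamma>. \<i> * of_real (k * (v \<bullet> u)) * W v * exp (\<i> * of_real (k * (v \<bullet> (fst p *\<^sub>R (x + u) + snd p)))))
      - (LINT v|?\<gamma>. \<i> * of_real (k * (v \<bullet> u)) * W v * exp (\<i> * of_real (k * (v \<bullet> (fst p *\<^sub>R x + snd p))))))
      = (LINT v|?\<gamma>. ?g u v)"
      unfolding Bochner_Integration.integral_diff[OF Ai Ai] A right_diff_distrib Bochner_Integration.integral_diff[OF Aj Aj] ..
  qed
  \<comment> \<open>One factor |k v| |u| comes from the inner product and one from
    \<open>\<Gamma>_diff\<close>; the Gaussian second moment makes the bound integrable in
    v.\<close>
  have gb: "norm (?g u v) \<le> (norm u)\<^sup>2 * (C * k\<^sup>2 * (norm v)\<^sup>2)" for u v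
  proof -
    have "norm (?g u v) \<le> C * ((norm (k *\<^sub>R v) * norm u) * (norm (k *\<^sub>R v) * norm u))"
      unfolding norm_mult norm_ii norm_of_real mult_1_left using C C0
      by (intro mult_mono \<Gamma>_diff Cauchy_Schwarz_ineq2) auto
    then show ?thesis using k by (simp add: power2_eq_square mult_ac)
  qed
  note F = Fubini_dominated[OF sigma_finite_\<nu> G.sigma_finite_measure_axioms _ gb sq_\<nu>]
  have mg: "(\<lambda>(u, v). ?g u v) \<in> borel_measurable (\<nu> \<Otimes>\<^sub>M ?\<gamma>)" by measurable
  have ig: "integrable ?\<gamma> (\<lambda>v. C * k\<^sup>2 * (norm v)\<^sup>2)" using integrable_gauss_sq by auto
  have eg: "(LINT u|\<nu>. ?g u v) = W v * (LINT u|\<nu>. \<i> * of_real ((k *\<^sub>R v) \<bullet> u) * (\<Gamma> (k *\<^sub>R v) (x + u) - \<Gamma> (k *\<^sub>R v) x))" for v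
    by (rule integral_mult_right_zero)
  have E: "(LINT u|\<nu>. LINT v|?\<gamma>. ?g u v) = (LINT v|?\<gamma>. W v * (LINT u|\<nu>. \<i> * of_real ((k *\<^sub>R v) \<bullet> u) * (\<Gamma> (k *\<^sub>R v) (x + u) - \<Gamma> (k *\<^sub>R v) x)))"
    using F(2)[OF mg ig] unfolding eg .
  have Ei: "integrable ?\<gamma> (\<lambda>v. W v * (LINT u|\<nu>. \<i> * of_real ((k *\<^sub>R v) \<bullet> u) * (\<Gamma> (k *\<^sub>R v) (x + u) - \<Gamma> (k *\<^sub>R v) x)))"
    using F(4)[OF mg ig] unfolding eg .
  have ex: "exp (\<i> * of_real (k * (v \<bullet> x))) = exp (\<i> * of_real ((k *\<^sub>R v) \<bullet> x))" for v by simp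
  show "(LINT v|?\<gamma>. W v * exp (\<i> * of_real (k * (v \<bullet> x)))) - (LINT z|M. LINT v|?\<gamma>. W v * exp (\<i> * of_real (k * (v \<bullet> z)))) =
    (LINT p|\<kappa>. LINT v|?\<gamma>. \<i> * of_real (k * (v \<bullet> x)) * W v * exp (\<i> * of_real (k * (v \<bullet> (fst p *\<^sub>R x + snd p))))) -
    (LINT u|\<nu>. LINT p|\<kappa>.
      (LINT v|?\<gamma>. \<i> * of_real (k * (v \<bullet> u)) * W v * exp (\<i> * of_real (k * (v \<bullet> (fst p *\<^sub>R (x + u) + snd p)))))
      - (LINT v|?\<gamma>. \<i> * of_real (k * (v \<bullet> u)) * W v * exp (\<i> * of_real (k * (v \<bullet> (fst p *\<^sub>R x + snd p))))))"
    unfolding A D E B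
    by (simp only: Bochner_Integration.integral_diff[OF iW iW', symmetric] Bochner_Integration.integral_diff[OF Aj Ei, symmetric]
      right_diff_distrib[symmetric]) (simp only: ex stein_exponential)
qed

text \<open>The uniform Lipschitz bound on the gradients is decisive: it bounds the inner increments
  by B |u|^2, an integrable majorant for \<nu>. The sup bound on the gradients alone would leave
  |u|, which need not be integrable near 0.\<close>

lemma stein_pair_limit:
  assumes pair: "\<And>n. stein_pair (h n) (H n)"
    and hm: "\<And>n. h n \<in> borel_measurable borel"
    and Hm: "\<And>n. case_prod (H n) \<in> borel_measurable (borel \<Otimes>\<^sub>M borel)"
    and hB: "\<And>n x. norm (h n x) \<le> B" and HB: "\<And>n x u. norm (H n x u) \<le> B * norm u"
    and HL: "\<And>n x y u. norm (H n x u - H n y u) \<le> B * norm (x - y) * norm u"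
    and hl: "\<And>x. (\<lambda>n. h n x) \<longlonglongrightarrow> h0 x" and Hl: "\<And>x u. (\<lambda>n. H n x u) \<longlonglongrightarrow> H0 x u"
  shows "stein_pair h0 H0"
  unfolding stein_pair_def
proof
  fix x
  note [measurable] = hm Hm
  have [measurable]: "h0 \<in> borel_measurable borel"
    by (rule borel_measurable_LIMSEQ_metric[OF hm hl])
  have [measurable]: "case_prod H0 \<in> borel_measurable (borel \<Otimes>\<^sub>M borel)"
    by (rule borel_measurable_LIMSEQ_metric[OF Hm]) (use Hl in auto)
  have mH [measurable]: "(\<lambda>q. H n (f q) (g q)) \<in> borel_measurable N"
    if [measurable]: "f \<in> borel_measurable N" "g \<in> borel_measurable N" for n and f g :: "'q \<Rightarrow> 'a" and N
    using measurable_compose[OF _ Hm, of "\<lambda>q. (f q, g q)" N n] by simp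
  have mH0 [measurable]: "(\<lambda>q. H0 (f q) (g q)) \<in> borel_measurable N"
    if [measurable]: "f \<in> borel_measurable N" "g \<in> borel_measurable N" for f g :: "'q \<Rightarrow> 'a" and N
    using measurable_compose[OF _ \<open>case_prod H0 \<in> _\<close>, of "\<lambda>q. (f q, g q)" N] by simp
  have B0: "0 \<le> B" using order_trans[OF norm_ge_zero hB] .
  have 1: "(\<lambda>n. h n x - (LINT z|M. h n z)) \<longlonglongrightarrow> h0 x - (LINT z|M. h0 z)"
    by (intro tendsto_diff hl integral_dominated_convergence[where w="\<lambda>_. B"]) (use hl hB in auto)
  have 2: "(\<lambda>n. LINT p|\<kappa>. H n (fst p *\<^sub>R x + snd p) x) \<longlonglongrightarrow> (LINT p|\<kappa>. H0 (fst p *\<^sub>R x + snd p) x)"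
    by (rule integral_dominated_convergence[where w="\<lambda>_. B * norm x"]) (use Hl HB in auto)
  let ?D = "\<lambda>H u p. H (fst p *\<^sub>R (x + u) + snd p) u - H (fst p *\<^sub>R x + snd p) u :: complex"
  have iD: "integrable \<kappa> (?D (H n) u)" for n u
  proof (rule \<kappa>.integrable_const_bound[of _ "B * norm u + B * norm u"], intro AE_I2)
    fix p :: "real \<times> 'a"
    show "norm (?D (H n) u p) \<le> B * norm u + B * norm u"
      by (rule order_trans[OF norm_triangle_ineq4]) (intro add_mono HB)
  qed measurable
  have bD: "norm (LINT p|\<kappa>. ?D (H n) u p) \<le> B * (norm u)\<^sup>2" for n u
  proof -
    have "norm (LINT p|\<kappa>. ?D (H n) u p) \<le> (LINT p|\<kappa>. norm (?D (H n) u p))"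
      by (rule integral_norm_bound)
    also have "\<dots> \<le> (LINT p|\<kappa>. B * (norm u)\<^sup>2)"
    proof (rule integral_mono_AE)
      show "AE p in \<kappa>. norm (?D (H n) u p) \<le> B * (norm u)\<^sup>2"
        using AE_\<kappa>
      proof eventually_elim
        case (elim p)
        have "norm (?D (H n) u p) \<le> B * norm (fst p *\<^sub>R (x + u) + snd p - (fst p *\<^sub>R x + snd p)) * norm u"
          by (rule HL)
        also have "\<dots> = B * (fst p * norm u) * norm u"
          using elim by (simp add: algebra_simps)
        also have "\<dots> \<le> B * (1 * norm u) * norm u"
          using elim B0 by (intro mult_mono) auto
        finally show ?case by (simp add: power2_eq_square mult_ac)
      qed
    qed (use iD in auto)
    finally show ?thesis by (simp add: \<kappa>.prob_space[simplified])
  qed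
  have 3: "(\<lambda>n. LINT u|\<nu>. LINT p|\<kappa>. ?D (H n) u p) \<longlonglongrightarrow> (LINT u|\<nu>. LINT p|\<kappa>. ?D H0 u p)"
  proof (rule integral_dominated_convergence[where w="\<lambda>u. B * (norm u)\<^sup>2"])
    show "AE u in \<nu>. (\<lambda>n. LINT p|\<kappa>. ?D (H n) u p) \<longlonglongrightarrow> (LINT p|\<kappa>. ?D H0 u p)"
    proof (intro AE_I2)
      fix u
      have "AE p in \<kappa>. norm (?D (H n) u p) \<le> B * norm u + B * norm u" for n
        by (intro AE_I2, rule order_trans[OF norm_triangle_ineq4]) (intro add_mono HB)
      then show "(\<lambda>n. LINT p|\<kappa>. ?D (H n) u p) \<longlonglongrightarrow> (LINT p|\<kappa>. ?D H0 u p)"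
        by (intro integral_dominated_convergence[where w="\<lambda>_. B * norm u + B * norm u"])
          (auto intro!: tendsto_intros Hl)
    qed
  qed (use bD sq_\<nu> in auto)
  have "(\<lambda>n. h n x - (LINT z|M. h n z)) \<longlonglongrightarrow>
     (LINT p|\<kappa>. H0 (fst p *\<^sub>R x + snd p) x) - (LINT u|\<nu>. LINT p|\<kappa>. ?D H0 u p)"
    using pair tendsto_diff[OF 2 3] by (simp add: stein_pair_def)
  with 1 show "h0 x - (LINT z|M. h0 z) =
     (LINT p|\<kappa>. H0 (fst p *\<^sub>R x + snd p) x) - (LINT u|\<nu>. LINT p|\<kappa>. ?D H0 u p)"
    by (rule LIMSEQ_unique)
qed

end

section \<open>The Stein equation for bounded functions with Lipschitz gradient\<close>

text \<open>Integrate $F(y+v) - F(y) = \int_0^1 F'(y+tv)dt$ over \<open>y\<close>; the left side gives 0 by translation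
  invariance.\<close>

lemma integral_directional_derivative_zero:
  fixes F F' :: "'a::euclidean_space \<Rightarrow> complex"
  assumes d: "\<And>y t. ((\<lambda>t. F (y + t *\<^sub>R v)) has_vector_derivative F' (y + t *\<^sub>R v)) (at t)"
    and F: "integrable lborel F" and F': "integrable lborel F'" and c: "continuous_on UNIV F'"
  shows "(LINT y|lborel. F' y) = 0"
proof -
  have [measurable]: "F' \<in> borel_measurable borel" using c by (rule borel_measurable_continuous_onI)
  have [measurable]: "F \<in> borel_measurable borel" using F borel_measurable_integrable by fastforce
  let ?f = "\<lambda>t y. indicator {0..1::real} t *\<^sub>R F' (y + t *\<^sub>R v)"
  have tr: "(LINT y|lborel. g (y + t)) = (LINT y|lborel. g y)" if "g \<in> borel_measurable borel"
    for g :: "'a \<Rightarrow> 'b::{banach, second_countable_topology}" and t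
    using lborel_integral_affine[of 1 g t] that by (simp add: add.commute)
  have tri: "integrable lborel (\<lambda>y. g (y + t))" if "integrable lborel g"
    for g :: "'a \<Rightarrow> 'b::{banach, second_countable_topology}" and t
    using lborel_integrable_affine[of 1 g t] that by (simp add: add.commute)
  have int: "integrable (lborel \<Otimes>\<^sub>M lborel) (case_prod ?f)"
  proof (rule lborel_pair.Fubini_integrable)
    have "(\<lambda>t. LINT y|lborel. norm (case (t, y) of (t, y) \<Rightarrow> ?f t y)) = (\<lambda>t. indicator {0..1} t * (LINT y|lborel. norm (F' y)))"
      using tr[of "\<lambda>y. norm (F' y)"] by (auto simp: fun_eq_iff)
    then show "integrable lborel (\<lambda>t. LINT y|lborel. norm (case (t, y) of (t, y) \<Rightarrow> ?f t y))"
      by simp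
    show "AE t in lborel. integrable lborel (\<lambda>y. case (t, y) of (t, y) \<Rightarrow> ?f t y)"
      using tri[OF F'] by simp
  qed measurable
  have ftc: "(LINT t|lborel. ?f t y) = F (y + v) - F y" for y
    by (subst integral_FTC_Icc[where F="\<lambda>t. F (y + t *\<^sub>R v)"])
      (auto intro!: has_vector_derivative_at_within[OF d] continuous_on_compose2[OF c] continuous_intros)
  have "0 = (LINT y|lborel. F (y + v) - F y)"
    using F tri[OF F] tr[of F] by simp
  also have "\<dots> = (LINT y|lborel. LINT t|lborel. ?f t y)"
    by (simp add: ftc)
  also have "\<dots> = (LINT t|lborel. LINT y|lborel. ?f t y)"
    using lborel_pair.Fubini_integral[OF int] by simp
  also have "\<dots> = (LINT t|lborel. indicator {0..1::real} t *\<^sub>R (LINT y|lborel. F' y))"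
    using tr[of F'] by simp
  also have "\<dots> = (LINT y|lborel. F' y)"
    by simp
  finally show ?thesis by simp
qed

text \<open>Integration by parts in direction \<open>u\<close>: the derivative of h times an
  exponential has integral zero. As a result the smoothed gradient is the very derivative form that
  \<open>stein_pair_mixture\<close> attaches to the smoothed function.\<close>

lemma gauss_weight_gradient:
  fixes h :: "'a::euclidean_space \<Rightarrow> real" and H :: "'a \<Rightarrow> 'a"
  assumes d: "\<And>x. (h has_derivative (\<lambda>v. H x \<bullet> v)) (at x)"
    and c: "continuous_on UNIV H" and h: "integrable lborel h" and H: "integrable lborel H"
  shows "gauss_weight k (\<lambda>y. of_real (H y \<bullet> u)) v =
     \<i> * of_real (k * (v \<bullet> u)) * gauss_weight k (\<lambda>y. of_real (h y)) v"
proof -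
  let ?e = "\<lambda>y. exp (- (\<i> * of_real (k * (v \<bullet> y)))) :: complex"
  let ?F = "\<lambda>y. of_real (h y) * ?e y"
  let ?F' = "\<lambda>y. of_real (H y \<bullet> u) * ?e y - \<i> * of_real (k * (v \<bullet> u)) * (of_real (h y) * ?e y)"
  have ch: "continuous_on UNIV h"
    using d has_derivative_continuous continuous_at_imp_continuous_on by blast
  have i1: "integrable lborel ?F"
    by (rule Bochner_Integration.integrable_bound[OF h])
      (use borel_measurable_continuous_onI[OF ch] in \<open>auto simp: norm_mult simp del: of_real_mult\<close>)
  have i2: "integrable lborel (\<lambda>y. of_real (H y \<bullet> u) * ?e y)"
  proof (rule Bochner_Integration.integrable_bound[of lborel "\<lambda>y. norm u * norm (H y)"])
    show "AE y in lborel. norm (of_real (H y \<bullet> u) * ?e y) \<le> norm (norm u * norm (H y))"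
      using Cauchy_Schwarz_ineq2[of "H _" u]
      by (intro AE_I2) (simp add: norm_mult mult.commute[of "norm u"] del: of_real_mult)
  qed (use H borel_measurable_continuous_onI[OF c] in auto)
  have "(LINT y|lborel. ?F' y) = 0"
  proof (rule integral_directional_derivative_zero[where v=u and F="?F"])
    fix y t
    have "((\<lambda>t. y + t *\<^sub>R u) has_derivative (\<lambda>s. s *\<^sub>R u)) (at t)"
      by (auto intro!: derivative_eq_intros)
    from diff_chain_at[OF this d]
    have "((\<lambda>t. h (y + t *\<^sub>R u)) has_vector_derivative (H (y + t *\<^sub>R u) \<bullet> u)) (at t)"
      by (simp add: has_vector_derivative_def o_def)
    then have 1: "((\<lambda>t. complex_of_real (h (y + t *\<^sub>R u))) has_vector_derivative of_real (H (y + t *\<^sub>R u) \<bullet> u)) (at t)"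
      using bounded_linear.has_vector_derivative[OF bounded_linear_of_real] by blast
    have 2: "((\<lambda>t. ?e (y + t *\<^sub>R u)) has_vector_derivative - (\<i> * of_real (k * (v \<bullet> u))) * ?e (y + t *\<^sub>R u)) (at t)"
    proof -
      have "((\<lambda>t. - (\<i> * of_real (k * (v \<bullet> y))) - t *\<^sub>R (\<i> * of_real (k * (v \<bullet> u)))) has_vector_derivative
          - (\<i> * of_real (k * (v \<bullet> u)))) (at t)"
        by (auto intro!: derivative_eq_intros)
      moreover have "- (\<i> * of_real (k * (v \<bullet> y))) - t *\<^sub>R (\<i> * of_real (k * (v \<bullet> u)))
          = - (\<i> * of_real (k * (v \<bullet> (y + t *\<^sub>R u))))" for t
        by (simp add: inner_add_right algebra_simps scaleR_conv_of_real)
      ultimately have "((\<lambda>t. - (\<i> * of_real (k * (v \<bullet> (y + t *\<^sub>R u))))) has_vector_derivative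
          - (\<i> * of_real (k * (v \<bullet> u)))) (at t)"
        by (simp only:)
      from field_vector_diff_chain_at[OF this DERIV_exp] show ?thesis
        by (simp only: o_def)
    qed
    show "((\<lambda>t. ?F (y + t *\<^sub>R u)) has_vector_derivative ?F' (y + t *\<^sub>R u)) (at t)"
      using has_vector_derivative_mult[OF 1 2] by (simp add: algebra_simps)
  next
    show "continuous_on UNIV ?F'"
      by (intro continuous_intros ch c)
  qed (use i1 i2 in auto)
  then have "(LINT y|lborel. of_real (H y \<bullet> u) * ?e y) = \<i> * of_real (k * (v \<bullet> u)) * (LINT y|lborel. ?F y)"
    using i1 i2 by simp
  then show ?thesis by (simp add: gauss_weight_def mult_ac)
qed

text \<open>With t = |a x| these bound the gradient of the Gaussian cutoff, make it integrable with
  half of the exponent to spare, and bound its second derivative.\<close>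

lemma t_exp_le_1: "t * exp (- t\<^sup>2 / 2) \<le> 1" "t * exp (- t\<^sup>2 / 4) \<le> 1" "(1 + t\<^sup>2) * exp (- t\<^sup>2 / 2) \<le> 2" for t :: real
proof -
  have "t \<le> 1 + t\<^sup>2 / 4" using zero_le_power2[of "t / 2 - 1"] by (simp add: power2_eq_square field_simps)
  also have "\<dots> \<le> exp (t\<^sup>2 / 4)" by (rule exp_ge_add_one_self)
  finally have 1: "t \<le> exp (t\<^sup>2 / 4)" .
  also have "\<dots> \<le> exp (t\<^sup>2 / 2)" by simp
  finally have 2: "t \<le> exp (t\<^sup>2 / 2)" .
  have 3: "1 + t\<^sup>2 \<le> 2 * exp (t\<^sup>2 / 2)" using exp_ge_add_one_self[of "t\<^sup>2 / 2"] by linarith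
  from 1 2 3 show "t * exp (- t\<^sup>2 / 2) \<le> 1" "t * exp (- t\<^sup>2 / 4) \<le> 1" "(1 + t\<^sup>2) * exp (- t\<^sup>2 / 2) \<le> 2"
    by (simp_all add: exp_minus divide_simps)
qed

text \<open>A Gaussian in place of a compactly supported bump: it tends to 1 as \<open>a\<close>
  tends to 0, its derivatives are explicit, and their bounds are uniform for \<open>a\<close> in
  (0,1].\<close>

definition cutoff :: "real \<Rightarrow> 'a::euclidean_space \<Rightarrow> real" where
  "cutoff a x = exp (- (norm (a *\<^sub>R x))\<^sup>2 / 2)"

text \<open>This is minus the gradient of \<open>cutoff a\<close>.\<close>

definition cutoff_grad :: "real \<Rightarrow> 'a::euclidean_space \<Rightarrow> 'a" where
  "cutoff_grad a x = a *\<^sub>R (cutoff a x *\<^sub>R (a *\<^sub>R x))"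

lemma cutoff_bounds: "0 \<le> cutoff a x" "cutoff a x \<le> 1"
  by (auto simp: cutoff_def)

lemma cutoff_has_derivative:
  "(cutoff a has_derivative (\<lambda>v. - (cutoff_grad a x \<bullet> v))) (at x)"
proof -
  have e: "cutoff a = (\<lambda>x. exp (- (a\<^sup>2 * (x \<bullet> x)) / 2))"
    by (simp add: cutoff_def[abs_def] power_mult_distrib power2_norm_eq_inner)
  show ?thesis
    unfolding e by (auto intro!: derivative_eq_intros simp: cutoff_grad_def e inner_commute power2_eq_square fun_eq_iff)
qed

lemma cutoff_grad_bound:
  assumes a: "0 \<le> a"
  shows "norm (cutoff_grad a x) \<le> a"
proof -
  have "norm (cutoff_grad a x) = a * (norm (a *\<^sub>R x) * exp (- (norm (a *\<^sub>R x))\<^sup>2 / 2))"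
    using a by (simp add: cutoff_grad_def cutoff_def)
  also have "\<dots> \<le> a * 1"
    using a by (intro mult_left_mono t_exp_le_1(1))
  finally show ?thesis by simp
qed

text \<open>The derivative in direction v is a^2 e^{-t^2/2} (v - <a x;v> a x) with t = |a x|, hence
  at most (1 + t^2) e^{-t^2/2} |v| \<le> 2 |v|, independently of \<open>a\<close>.\<close>

lemma cutoff_grad_lipschitz:
  assumes a: "0 \<le> a" "a \<le> 1"
  shows "norm (cutoff_grad a x - cutoff_grad a y) \<le> 2 * norm (x - y)"
proof (rule differentiable_bound[of UNIV "cutoff_grad a" "\<lambda>x v. a *\<^sub>R (cutoff a x *\<^sub>R (a *\<^sub>R v) - (cutoff_grad a x \<bullet> v) *\<^sub>R (a *\<^sub>R x))"])
  fix x :: 'a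
  show "(cutoff_grad a has_derivative (\<lambda>v. a *\<^sub>R (cutoff a x *\<^sub>R (a *\<^sub>R v) - (cutoff_grad a x \<bullet> v) *\<^sub>R (a *\<^sub>R x)))) (at x within UNIV)"
    unfolding cutoff_grad_def[abs_def]
    by (auto intro!: derivative_eq_intros cutoff_has_derivative simp: cutoff_grad_def algebra_simps)
  show "onorm (\<lambda>v. a *\<^sub>R (cutoff a x *\<^sub>R (a *\<^sub>R v) - (cutoff_grad a x \<bullet> v) *\<^sub>R (a *\<^sub>R x))) \<le> 2"
  proof (rule onorm_le)
    fix v
    let ?t = "norm (a *\<^sub>R x)"
    have n: "\<bar>cutoff_grad a x \<bullet> v\<bar> \<le> a * cutoff a x * ?t * norm v"
      using a Cauchy_Schwarz_ineq2[of "cutoff_grad a x" v] cutoff_bounds(1)[of a x]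
      by (simp add: cutoff_grad_def mult_ac)
    have "norm (a *\<^sub>R (cutoff a x *\<^sub>R (a *\<^sub>R v) - (cutoff_grad a x \<bullet> v) *\<^sub>R (a *\<^sub>R x)))
       \<le> a * (cutoff a x * (a * norm v) + \<bar>cutoff_grad a x \<bullet> v\<bar> * ?t)"
    proof -
      have "norm (cutoff a x *\<^sub>R (a *\<^sub>R v) - (cutoff_grad a x \<bullet> v) *\<^sub>R (a *\<^sub>R x))
          \<le> norm (cutoff a x *\<^sub>R (a *\<^sub>R v)) + norm ((cutoff_grad a x \<bullet> v) *\<^sub>R (a *\<^sub>R x))"
        by (rule norm_triangle_ineq4)
      from mult_left_mono[OF this a(1)] show ?thesis
        using a cutoff_bounds(1)[of a x] by (simp add: abs_mult mult.assoc)
    qed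
    also have "\<dots> \<le> a * (cutoff a x * (a * norm v) + (a * cutoff a x * ?t * norm v) * ?t)"
      using a n by (intro mult_left_mono add_left_mono mult_right_mono) auto
    also have "\<dots> = (a * a) * (((1 + ?t\<^sup>2) * exp (- ?t\<^sup>2 / 2)) * norm v)"
      by (simp add: cutoff_def power2_eq_square algebra_simps)
    also have "\<dots> \<le> 1 * (2 * norm v)"
      using a by (intro mult_mono t_exp_le_1(3)) (auto simp: mult_le_one)
    finally show "norm (a *\<^sub>R (cutoff a x *\<^sub>R (a *\<^sub>R v) - (cutoff_grad a x \<bullet> v) *\<^sub>R (a *\<^sub>R x))) \<le> 2 * norm v"
      by simp
  qed
qed auto

lemma gradient_bound_lipschitz:
  fixes h :: "'a::euclidean_space \<Rightarrow> real"
  assumes d: "\<And>x. (h has_derivative (\<lambda>v. H x \<bullet> v)) (at x)" and B: "\<And>x. norm (H x) \<le> B"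
  shows "\<bar>h x - h y\<bar> \<le> B * norm (x - y)"
proof -
  have "norm (h x - h y) \<le> B * norm (x - y)"
  proof (rule differentiable_bound[of UNIV h "\<lambda>x v. H x \<bullet> v"])
    fix x
    show "onorm (\<lambda>v. H x \<bullet> v) \<le> B"
    proof (rule onorm_le)
      fix v
      show "norm (H x \<bullet> v) \<le> B * norm v"
        using Cauchy_Schwarz_ineq2[of "H x" v] mult_right_mono[OF B[of x] norm_ge_zero[of v]] by simp
    qed
  qed (use d in auto)
  then show ?thesis by simp
qed

lemma cutoff_lipschitz:
  assumes a: "0 \<le> a" "a \<le> 1"
  shows "\<bar>cutoff a x - cutoff a y\<bar> \<le> norm (x - y)"
  using gradient_bound_lipschitz[of "cutoff a" "\<lambda>x. - cutoff_grad a x" 1 x y] cutoff_has_derivative[of a]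
    order_trans[OF cutoff_grad_bound[OF a(1)] a(2)]
  by auto

lemma integrable_cutoff: "0 < a \<Longrightarrow> integrable lborel (cutoff a :: 'a::euclidean_space \<Rightarrow> real)"
  using integrable_exp_norm_sq[of "a\<^sup>2 / 2", where 'a='a]
  by (simp add: cutoff_def[abs_def] power_mult_distrib)

lemma cutoff_measurable [measurable]: "cutoff a \<in> borel_measurable borel"
  unfolding cutoff_def[abs_def] by measurable

lemma cutoff_grad_measurable [measurable]: "cutoff_grad a \<in> borel_measurable borel"
  unfolding cutoff_grad_def[abs_def] by measurable

lemma integrable_cutoff_grad:
  assumes a: "0 < a"
  shows "integrable lborel (cutoff_grad a :: 'a::euclidean_space \<Rightarrow> 'a)"
proof (rule Bochner_Integration.integrable_bound)
  show "integrable lborel (\<lambda>x::'a. a * exp (- (a\<^sup>2 / 4) * (norm x)\<^sup>2))"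
    using a by (intro integrable_mult_right integrable_exp_norm_sq) auto
  show "AE x in lborel. norm (cutoff_grad a x :: 'a) \<le> norm (a * exp (- (a\<^sup>2 / 4) * (norm x)\<^sup>2))"
  proof (intro AE_I2)
    fix x :: 'a
    let ?t = "norm (a *\<^sub>R x)"
    have "exp (- ?t\<^sup>2 / 2) = exp (- ?t\<^sup>2 / 4) * exp (- ?t\<^sup>2 / 4)"
      by (simp flip: exp_add)
    then have "norm (cutoff_grad a x) = a * ((?t * exp (- ?t\<^sup>2 / 4)) * exp (- ?t\<^sup>2 / 4))"
      using a by (simp add: cutoff_grad_def cutoff_def)
    also have "\<dots> \<le> a * (1 * exp (- ?t\<^sup>2 / 4))"
      using a by (intro mult_left_mono mult_right_mono t_exp_le_1) auto
    also have "\<dots> = norm (a * exp (- (a\<^sup>2 / 4) * (norm x)\<^sup>2))"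
      using a by (simp add: power_mult_distrib)
    finally show "norm (cutoff_grad a x) \<le> norm (a * exp (- (a\<^sup>2 / 4) * (norm x)\<^sup>2))" .
  qed
qed simp

section \<open>From integrable functions to bounded ones\<close>

context stein_setup
begin

text \<open>Averaging \<open>h\<close> and \<open>H\<close> over the same Gaussian noise preserves
  the sup bounds and the Lipschitz constant, so the uniform bounds demanded by
  \<open>stein_pair_limit\<close> are those of \<open>h\<close> and \<open>H\<close>
  themselves.\<close>

lemma stein_pair_integrable:
  fixes h :: "'a \<Rightarrow> real" and H :: "'a \<Rightarrow> 'a"
  assumes d: "\<And>x. (h has_derivative (\<lambda>v. H x \<bullet> v)) (at x)" and c: "continuous_on UNIV H"
    and h: "integrable lborel h" and H: "integrable lborel H"
    and hB: "\<And>x. \<bar>h x\<bar> \<le> B" and HB: "\<And>x. norm (H x) \<le> B"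
    and HL: "\<And>x y. norm (H x - H y) \<le> B * norm (x - y)"
  shows "stein_pair (\<lambda>x. of_real (h x)) (\<lambda>x u. of_real (H x \<bullet> u))"
proof (rule stein_pair_limit[where B=B])
  let ?\<gamma> = "gauss_measure :: 'a measure"
  let ?h = "\<lambda>n x. LINT z|?\<gamma>. complex_of_real (h (x + (1 / real (Suc n)) *\<^sub>R z))"
  let ?H = "\<lambda>n x u. LINT z|?\<gamma>. complex_of_real (H (x + (1 / real (Suc n)) *\<^sub>R z) \<bullet> u)"
  have ch: "continuous_on UNIV h"
    using d has_derivative_continuous continuous_at_imp_continuous_on by blast
  have [measurable]: "h \<in> borel_measurable borel" "H \<in> borel_measurable borel"
    using borel_measurable_continuous_onI[OF ch] borel_measurable_continuous_onI[OF c] .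
  have Hu: "\<bar>H x \<bullet> u\<bar> \<le> B * norm u" for x u
    using Cauchy_Schwarz_ineq2[of "H x" u] mult_right_mono[OF HB[of x] norm_ge_zero[of u]] by simp
  have av: "norm (LINT z|?\<gamma>. f z) \<le> b" if "\<And>z. norm (f z) \<le> b" "f \<in> borel_measurable borel" for f :: "'a \<Rightarrow> complex" and b
  proof -
    have "integrable ?\<gamma> f" by (rule G.integrable_const_bound[of _ b]) (use that in auto)
    then have "norm (LINT z|?\<gamma>. f z) \<le> (LINT z|?\<gamma>. b)"
      by (intro Bochner_Integration.integral_norm_bound_integral) (use that in auto)
    then show ?thesis by (simp add: G.prob_space[simplified])
  qed
  show "stein_pair (?h n) (?H n)" for n
  proof -
    let ?k = "real (Suc n)"
    let ?W = "gauss_weight ?k (\<lambda>y. of_real (h y))"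
    obtain C where C: "\<And>v. norm (?W v) \<le> C"
      using gauss_weight_bound[OF integrable_of_real[OF h], of ?k] by auto
    have "?h n = (\<lambda>x. LINT v|?\<gamma>. ?W v * exp (\<i> * of_real (?k * (v \<bullet> x))))"
      by (intro ext gauss_smoothing integrable_of_real h) simp
    moreover have "?H n = (\<lambda>x u. LINT v|?\<gamma>. \<i> * of_real (?k * (v \<bullet> u)) * ?W v * exp (\<i> * of_real (?k * (v \<bullet> x))))"
    proof (intro ext)
      fix x u
      have "integrable lborel (\<lambda>y. complex_of_real (H y \<bullet> u))"
        using H by (intro integrable_of_real) simp
      from gauss_smoothing[OF this, of ?k]
      show "?H n x u = (LINT v|?\<gamma>. \<i> * of_real (?k * (v \<bullet> u)) * ?W v * exp (\<i> * of_real (?k * (v \<bullet> x))))"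
        unfolding gauss_weight_gradient[OF d c h H] by simp
    qed
    ultimately show ?thesis
      using stein_pair_mixture[of ?W C ?k] C by simp
  qed
  show "norm (?h n x) \<le> B" for n x
    by (rule av) (use hB in auto)
  show "norm (?H n x u) \<le> B * norm u" for n x u
    by (rule av) (use Hu in auto)
  show "norm (?H n x u - ?H n y u) \<le> B * norm (x - y) * norm u" for n x y u
  proof -
    have i: "integrable ?\<gamma> (\<lambda>z. complex_of_real (H (x + (1 / real (Suc n)) *\<^sub>R z) \<bullet> u))" for x
      by (rule G.integrable_const_bound[of _ "B * norm u"]) (use Hu in auto)
    have "?H n x u - ?H n y u = (LINT z|?\<gamma>. complex_of_real ((H (x + (1 / real (Suc n)) *\<^sub>R z) - H (y + (1 / real (Suc n)) *\<^sub>R z)) \<bullet> u))"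
      using Bochner_Integration.integral_diff[OF i[of x] i[of y]] by (simp add: inner_diff_left)
    also have "norm \<dots> \<le> B * norm (x - y) * norm u"
    proof (rule av)
      fix z
      have "\<bar>(H (x + (1 / real (Suc n)) *\<^sub>R z) - H (y + (1 / real (Suc n)) *\<^sub>R z)) \<bullet> u\<bar>
        \<le> norm (H (x + (1 / real (Suc n)) *\<^sub>R z) - H (y + (1 / real (Suc n)) *\<^sub>R z)) * norm u"
        by (rule Cauchy_Schwarz_ineq2)
      also have "\<dots> \<le> B * norm (x - y) * norm u"
        using HL[of "x + (1 / real (Suc n)) *\<^sub>R z" "y + (1 / real (Suc n)) *\<^sub>R z"]
        by (intro mult_right_mono) auto
      finally show "norm (complex_of_real ((H (x + (1 / real (Suc n)) *\<^sub>R z) - H (y + (1 / real (Suc n)) *\<^sub>R z)) \<bullet> u)) \<le> B * norm (x - y) * norm u"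
        unfolding norm_of_real .
    qed measurable
    finally show ?thesis .
  qed
  show "(\<lambda>n. ?h n x) \<longlonglongrightarrow> of_real (h x)" for x
    by (rule gauss_smoothing_tendsto[where f="\<lambda>x. complex_of_real (h x)" and B=B]) (use hB ch in \<open>auto intro!: continuous_intros\<close>)
  show "(\<lambda>n. ?H n x u) \<longlonglongrightarrow> of_real (H x \<bullet> u)" for x u
    by (rule gauss_smoothing_tendsto[where f="\<lambda>x. complex_of_real (H x \<bullet> u)" and B="B * norm u"])
      (use Hu c in \<open>auto intro!: continuous_intros\<close>)
  show "?h n \<in> borel_measurable borel" for n
    by measurable
  show "case_prod (?H n) \<in> borel_measurable (borel \<Otimes>\<^sub>M borel)" for n
    by measurable
qed

text \<open>Multiplication by \<open>cutoff (a n)\<close> makes the function and its gradient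
  integrable, while every bound stays below 5 B for all n.\<close>

lemma stein_pair_bounded:
  fixes h :: "'a \<Rightarrow> real" and H :: "'a \<Rightarrow> 'a"
  assumes d: "\<And>x. (h has_derivative (\<lambda>v. H x \<bullet> v)) (at x)"
    and hB: "\<And>x. \<bar>h x\<bar> \<le> B" and HB: "\<And>x. norm (H x) \<le> B"
    and HL: "\<And>x y. norm (H x - H y) \<le> B * norm (x - y)"
  shows "stein_pair (\<lambda>x. of_real (h x)) (\<lambda>x u. of_real (H x \<bullet> u))"
proof -
  have B0: "0 \<le> B" using order_trans[OF abs_ge_zero hB] .
  have ch: "continuous_on UNIV h"
    using d has_derivative_continuous continuous_at_imp_continuous_on by blast
  have cH: "continuous_on UNIV H"
    by (rule lipschitz_on_continuous_on[of B]) (use HL B0 in \<open>auto intro!: lipschitz_onI simp: dist_norm\<close>)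
  have [measurable]: "h \<in> borel_measurable borel" "H \<in> borel_measurable borel"
    using borel_measurable_continuous_onI[OF ch] borel_measurable_continuous_onI[OF cH] .
  define a where "a n = 1 / real (Suc n)" for n
  have a: "0 < a n" "0 \<le> a n" "a n \<le> 1" for n by (auto simp: a_def)
  have a_lim: "a \<longlonglongrightarrow> 0" unfolding a_def by (rule LIMSEQ_Suc[OF lim_1_over_n])
  define h' where "h' n x = cutoff (a n) x * h x" for n x
  \<comment> \<open>Product rule; the minus sign is that of \<open>cutoff_grad\<close>.\<close>
  define H' where "H' n x = cutoff (a n) x *\<^sub>R H x - h x *\<^sub>R cutoff_grad (a n) x" for n x
  have [measurable]: "h' n \<in> borel_measurable borel" "H' n \<in> borel_measurable borel" for n
    unfolding h'_def[abs_def] H'_def[abs_def] by measurable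
  have h'B: "\<bar>h' n x\<bar> \<le> 1 * B" for n x
    unfolding h'_def abs_mult using cutoff_bounds[of "a n" x] hB[of x] by (intro mult_mono) auto
  have H'B: "norm (H' n x) \<le> 1 * B + B * 1" for n x
  proof -
    have "norm (H' n x) \<le> norm (cutoff (a n) x *\<^sub>R H x) + norm (h x *\<^sub>R cutoff_grad (a n) x)"
      unfolding H'_def by (rule norm_triangle_ineq4)
    also have "\<dots> \<le> 1 * B + B * 1"
      unfolding norm_scaleR
      using cutoff_bounds[of "a n" x] hB[of x] HB[of x] B0 order_trans[OF cutoff_grad_bound a(3), of n x] a(2)[of n]
      by (intro add_mono mult_mono) auto
    finally show ?thesis .
  qed
  have H'L: "norm (H' n x - H' n y) \<le> 5 * B * norm (x - y)" for n x y
  proof -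
    let ?c = "cutoff (a n)" and ?g = "cutoff_grad (a n)"
    have "H' n x - H' n y = ?c x *\<^sub>R (H x - H y) + (?c x - ?c y) *\<^sub>R H y - (h x *\<^sub>R (?g x - ?g y) + (h x - h y) *\<^sub>R ?g y)"
      by (simp add: H'_def algebra_simps)
    also have "norm \<dots> \<le> (\<bar>?c x\<bar> * norm (H x - H y) + \<bar>?c x - ?c y\<bar> * norm (H y)) + (\<bar>h x\<bar> * norm (?g x - ?g y) + \<bar>h x - h y\<bar> * norm (?g y))"
      unfolding norm_scaleR[symmetric]
      by (intro order_trans[OF norm_triangle_ineq4] add_mono norm_triangle_ineq)
    \<comment> \<open>The four differences of the product rule contribute 1 + 1 + 2 + 1 = 5, with 2
      from \<open>cutoff_grad_lipschitz\<close>.\<close>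
    also have "\<dots> \<le> (1 * (B * norm (x - y)) + norm (x - y) * B) + (B * (2 * norm (x - y)) + (B * norm (x - y)) * 1)"
      using cutoff_bounds[of "a n" x] a(2,3)[of n] B0 order_trans[OF cutoff_grad_bound a(3), of n y]
      by (intro add_mono mult_mono HL hB HB cutoff_lipschitz cutoff_grad_lipschitz gradient_bound_lipschitz[OF d HB]) auto
    finally show ?thesis by simp
  qed
  show ?thesis
  proof (rule stein_pair_limit[where B="5 * B" and h="\<lambda>n x. of_real (h' n x)" and H="\<lambda>n x u. of_real (H' n x \<bullet> u)"])
    show "stein_pair (\<lambda>x. of_real (h' n x)) (\<lambda>x u. of_real (H' n x \<bullet> u))" for n
    proof (rule stein_pair_integrable[where B="5 * B"])
      show "(h' n has_derivative (\<lambda>v. H' n x \<bullet> v)) (at x)" for x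
        unfolding h'_def H'_def
        by (rule has_derivative_eq_rhs, rule has_derivative_mult[OF cutoff_has_derivative d])
          (simp add: fun_eq_iff inner_diff_left)
      show "integrable lborel (h' n)"
      proof (rule Bochner_Integration.integrable_bound)
        show "integrable lborel (\<lambda>x::'a. B * cutoff (a n) x)"
          using a by (intro integrable_mult_right integrable_cutoff)
        show "AE x in lborel. norm (h' n x) \<le> norm (B * cutoff (a n) x)"
          using hB B0 cutoff_bounds(1)
          by (intro AE_I2) (auto simp: h'_def abs_mult mult.commute intro!: mult_mono)
      qed simp
      show "integrable lborel (H' n)"
      proof (rule Bochner_Integration.integrable_bound)
        show "integrable lborel (\<lambda>x::'a. B * cutoff (a n) x + B * norm (cutoff_grad (a n) x))"
          using a by (intro Bochner_Integration.integrable_add integrable_mult_right integrable_cutoff integrable_norm integrable_cutoff_grad)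
        show "AE x in lborel. norm (H' n x) \<le> norm (B * cutoff (a n) x + B * norm (cutoff_grad (a n) x))"
        proof (intro AE_I2)
          fix x
          have "norm (H' n x) \<le> norm (cutoff (a n) x *\<^sub>R H x) + norm (h x *\<^sub>R cutoff_grad (a n) x)"
            unfolding H'_def by (rule norm_triangle_ineq4)
          also have "\<dots> \<le> B * cutoff (a n) x + B * norm (cutoff_grad (a n) x)"
            unfolding norm_scaleR mult.commute[of "\<bar>cutoff _ _\<bar>"]
            using cutoff_bounds[of "a n" x] hB[of x] HB[of x] B0 by (intro add_mono mult_mono) auto
          finally show "norm (H' n x) \<le> norm (B * cutoff (a n) x + B * norm (cutoff_grad (a n) x))"
            by simp
        qed
      qed simp
      show "continuous_on UNIV (H' n)"
        by (rule lipschitz_on_continuous_on[of "5 * B"]) (use H'L B0 in \<open>auto intro!: lipschitz_onI simp: dist_norm\<close>)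
      show "\<bar>h' n x\<bar> \<le> 5 * B" "norm (H' n x) \<le> 5 * B" for x
        using h'B[of n x] H'B[of n x] B0 by auto
      show "norm (H' n x - H' n y) \<le> 5 * B * norm (x - y)" for x y by (rule H'L)
    qed
    show "norm (complex_of_real (h' n x)) \<le> 5 * B" for n x using h'B[of n x] B0 by simp
    show "norm (complex_of_real (H' n x \<bullet> u)) \<le> 5 * B * norm u" for n x u
      using Cauchy_Schwarz_ineq2[of "H' n x" u] H'B[of n x] B0
        mult_right_mono[OF order_trans[OF H'B[of n x], of "5 * B"] norm_ge_zero[of u]] by simp
    show "norm (complex_of_real (H' n x \<bullet> u) - complex_of_real (H' n y \<bullet> u)) \<le> 5 * B * norm (x - y) * norm u" for n x y u
      using Cauchy_Schwarz_ineq2[of "H' n x - H' n y" u] mult_right_mono[OF H'L[of n x y] norm_ge_zero[of u]]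
      by (simp add: inner_diff_left flip: of_real_diff)
    have cl: "(\<lambda>n. cutoff (a n) x) \<longlonglongrightarrow> 1" for x :: 'a
    proof -
      have "(\<lambda>n. cutoff (a n) x) \<longlonglongrightarrow> exp (- (norm (0 *\<^sub>R x))\<^sup>2 / 2)"
        unfolding cutoff_def by (intro tendsto_intros a_lim) auto
      then show ?thesis by simp
    qed
    have gl: "(\<lambda>n. cutoff_grad (a n) x) \<longlonglongrightarrow> 0" for x :: 'a
    proof -
      have "(\<lambda>n. cutoff_grad (a n) x) \<longlonglongrightarrow> 0 *\<^sub>R (1 *\<^sub>R (0 *\<^sub>R x))"
        unfolding cutoff_grad_def by (intro tendsto_intros a_lim cl)
      then show ?thesis by simp
    qed
    show "(\<lambda>n. complex_of_real (h' n x)) \<longlonglongrightarrow> of_real (h x)" for x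
    proof -
      have "(\<lambda>n. complex_of_real (h' n x)) \<longlonglongrightarrow> of_real (1 * h x)"
        unfolding h'_def by (intro tendsto_intros cl)
      then show ?thesis by simp
    qed
    show "(\<lambda>n. complex_of_real (H' n x \<bullet> u)) \<longlonglongrightarrow> of_real (H x \<bullet> u)" for x u
    proof -
      have "(\<lambda>n. complex_of_real (H' n x \<bullet> u)) \<longlonglongrightarrow> of_real ((1 *\<^sub>R H x - h x *\<^sub>R 0) \<bullet> u)"
        unfolding H'_def by (intro tendsto_intros cl gl)
      then show ?thesis by simp
    qed
    show "(\<lambda>x. complex_of_real (h' n x)) \<in> borel_measurable borel" for n
      by measurable
    show "(\<lambda>(x, u). complex_of_real (H' n x \<bullet> u)) \<in> borel_measurable (borel \<Otimes>\<^sub>M borel)" for n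
      by measurable
  qed
qed

end

section \<open>The bound on the smooth Wasserstein distance\<close>

lemma Cauchy_Schwarz_integral:
  fixes f g :: "'b \<Rightarrow> real"
  assumes [measurable]: "f \<in> borel_measurable M" "g \<in> borel_measurable M"
    and f: "integrable M (\<lambda>x. (f x)\<^sup>2)" and g: "integrable M (\<lambda>x. (g x)\<^sup>2)"
  shows "integrable M (\<lambda>x. f x * g x)"
    and "(LINT x|M. f x * g x) \<le> sqrt (LINT x|M. (f x)\<^sup>2) * sqrt (LINT x|M. (g x)\<^sup>2)"
proof -
  show fg: "integrable M (\<lambda>x. f x * g x)"
  proof (rule Bochner_Integration.integrable_bound[OF Bochner_Integration.integrable_add[OF f g]])
    show "AE x in M. norm (f x * g x) \<le> norm ((f x)\<^sup>2 + (g x)\<^sup>2)"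
    proof (intro AE_I2)
      fix x
      have "0 \<le> (\<bar>f x\<bar> - \<bar>g x\<bar>)\<^sup>2" by simp
      then have "2 * (\<bar>f x\<bar> * \<bar>g x\<bar>) \<le> (f x)\<^sup>2 + (g x)\<^sup>2" by (simp add: power2_diff)
      moreover have "0 \<le> \<bar>f x\<bar> * \<bar>g x\<bar>" by simp
      ultimately show "norm (f x * g x) \<le> norm ((f x)\<^sup>2 + (g x)\<^sup>2)"
        unfolding real_norm_def abs_mult by linarith
    qed
  qed measurable
  define A where "A = (LINT x|M. (f x)\<^sup>2)"
  define B where "B = (LINT x|M. (g x)\<^sup>2)"
  define C where "C = (LINT x|M. f x * g x)"
  have q: "0 \<le> A - 2 * t * C + t\<^sup>2 * B" for t
  proof -
    have "0 \<le> (LINT x|M. (f x - t * g x)\<^sup>2)" by simp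
    also have "\<dots> = (LINT x|M. (f x)\<^sup>2 - 2 * t * (f x * g x) + t\<^sup>2 * (g x)\<^sup>2)"
      by (simp add: power2_diff power_mult_distrib algebra_simps)
    also have "\<dots> = A - 2 * t * C + t\<^sup>2 * B"
      unfolding A_def B_def C_def using f g fg by simp
    finally show ?thesis .
  qed
  have "C\<^sup>2 \<le> A * B"
  proof (cases "B = 0")
    case True
    have "C = 0"
    proof (rule ccontr)
      assume "C \<noteq> 0"
      \<comment> \<open>For B = 0 the quadratic is affine in t; at this t it equals -1.\<close>
      then show False using q[of "(A + 1) / (2 * C)"] True by simp
    qed
    then show ?thesis using True by simp
  next
    case False
    moreover have "0 \<le> B" by (simp add: B_def)
    ultimately have B: "0 < B" by simp
    \<comment> \<open>The quadratic in t is smallest at t = C / B.\<close>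
    have "0 \<le> (A - 2 * (C / B) * C + (C / B)\<^sup>2 * B) * B"
      using q[of "C / B"] B by (intro mult_nonneg_nonneg) auto
    also have "\<dots> = A * B - C\<^sup>2" using B by (simp add: field_simps power2_eq_square)
    finally show ?thesis by simp
  qed
  then have "\<bar>C\<bar> \<le> sqrt (A * B)" by (simp add: real_le_rsqrt)
  then show "(LINT x|M. f x * g x) \<le> sqrt (LINT x|M. (f x)\<^sup>2) * sqrt (LINT x|M. (g x)\<^sup>2)"
    by (simp add: A_def B_def C_def real_sqrt_mult)
qed

text \<open>\<open>H\<close> is assembled from the partial derivatives. The operator norms speak of
  unit vectors only, so homogeneity extends them to all directions; the second-order bound becomes a
  Lipschitz constant by the mean value inequality, applied to each directional derivative.\<close>

lemma wasserstein_test_gradient: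
  fixes h :: "'a::euclidean_space \<Rightarrow> real"
  assumes h: "h \<in> wasserstein_test 2"
  obtains H where "\<And>x. (h has_derivative (\<lambda>v. H x \<bullet> v)) (at x)" "\<And>x. \<bar>h x\<bar> \<le> 1" "\<And>x. norm (H x) \<le> 1"
    "\<And>x y. norm (H x - H y) \<le> norm (x - y)"
proof -
  have tcd: "times_cont_differentiable 2 h" and db: "\<And>l. l \<le> 2 \<Longrightarrow> deriv_bound l h \<le> 1"
    using h by (auto simp: wasserstein_test_def)
  have bound: "\<bar>iter_deriv h vs x\<bar> \<le> 1" if "length vs \<le> 2" "\<forall>v\<in>set vs. norm v = 1" for vs x
  proof -
    have "ennreal \<bar>iter_deriv h vs x\<bar> \<le> deriv_bound (length vs) h"
      unfolding deriv_bound_def using that by (intro SUP_upper2[of x] SUP_upper2[of vs]) auto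
    also have "\<dots> \<le> 1" by (rule db) fact
    finally show ?thesis by simp
  qed
  have diff: "(iter_deriv h vs has_derivative (\<lambda>v. iter_deriv h (v # vs) x)) (at x)" if "length vs < 2" for vs x
    using tcd that by (auto simp: times_cont_differentiable_def frechet_derivative_works[symmetric] eta_contract_eq)
  have scale: "\<bar>iter_deriv h (v # vs) x\<bar> \<le> norm v" if "length vs < 2" "\<forall>v\<in>set vs. norm v = 1" for v vs x
  proof (cases "v = 0")
    case True
    then show ?thesis using linear_0[OF has_derivative_linear[OF diff[OF that(1)]]] by simp
  next
    case False
    have "iter_deriv h (v # vs) x = norm v * iter_deriv h (sgn v # vs) x"
      using linear_scale[OF has_derivative_linear[OF diff[OF that(1)]], of "norm v" "sgn v" x] False
      by (simp add: sgn_div_norm)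
    moreover have "\<bar>iter_deriv h (sgn v # vs) x\<bar> \<le> 1"
      using that False by (intro bound) (auto simp: norm_sgn)
    ultimately show ?thesis by (simp add: abs_mult mult_left_le)
  qed
  define H where "H x = (\<Sum>b\<in>Basis. iter_deriv h [b] x *\<^sub>R b)" for x
  have Hv: "H x \<bullet> v = iter_deriv h [v] x" for x v
  proof -
    have l: "linear (\<lambda>v. iter_deriv h [v] x)"
      using has_derivative_linear[OF diff[of "[]" x]] by simp
    have "iter_deriv h [v] x = iter_deriv h [\<Sum>b\<in>Basis. (v \<bullet> b) *\<^sub>R b] x"
      by (simp only: euclidean_representation)
    also have "\<dots> = (\<Sum>b\<in>Basis. (v \<bullet> b) * iter_deriv h [b] x)"
      using linear_sum[OF l, of "\<lambda>b. (v \<bullet> b) *\<^sub>R b" Basis] linear_scale[OF l] by simp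
    also have "\<dots> = H x \<bullet> v"
      by (simp add: H_def inner_sum_left inner_commute[of v] mult.commute)
    finally show ?thesis by simp
  qed
  \<comment> \<open>The norm is attained at the unit vector \<open>sgn z\<close>, which passes from
    bounds on forms to bounds on vectors.\<close>
  have norm_le: "norm z \<le> c" if "\<And>v. norm v = 1 \<Longrightarrow> \<bar>z \<bullet> v\<bar> \<le> c" "0 \<le> c" for z :: 'a and c
  proof (cases "z = 0")
    case False
    then have "\<bar>z \<bullet> sgn z\<bar> = norm z"
      by (simp add: sgn_div_norm power2_norm_eq_inner[symmetric] power2_eq_square)
    then show ?thesis using that(1)[of "sgn z"] False by (simp add: norm_sgn)
  qed (use that in simp)
  show thesis
  proof
    show "(h has_derivative (\<lambda>v. H x \<bullet> v)) (at x)" for x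
      using diff[of "[]" x] by (simp add: Hv)
    show "\<bar>h x\<bar> \<le> 1" for x using bound[of "[]" x] by simp
    show "norm (H x) \<le> 1" for x
      unfolding Hv by (rule norm_le) (use bound[of "[_]" x] in \<open>auto simp: Hv simp del: iter_deriv.simps\<close>)
    show "norm (H x - H y) \<le> norm (x - y)" for x y
    proof (rule norm_le)
      fix v :: 'a assume v: "norm v = 1"
      have "norm (iter_deriv h [v] x - iter_deriv h [v] y) \<le> 1 * norm (x - y)"
      \<comment> \<open>The head of the list is differentiated last, so \<open>[w, v]\<close> is the
        derivative in direction w of the derivative along v.\<close>
      proof (rule differentiable_bound[of UNIV _ "\<lambda>x w. iter_deriv h [w, v] x"])
        show "(iter_deriv h [v] has_derivative (\<lambda>w. iter_deriv h [w, v] x)) (at x within UNIV)" for x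
          using diff[of "[v]" x] by simp
        show "onorm (\<lambda>w. iter_deriv h [w, v] x) \<le> 1" for x
          using scale[of "[v]" _ x] v by (intro onorm_le) (auto simp del: iter_deriv.simps)
      qed auto
      then show "\<bar>(H x - H y) \<bullet> v\<bar> \<le> norm (x - y)"
        by (simp add: inner_diff_left Hv del: iter_deriv.simps)
    qed auto
  qed
qed

section \<open>Regularity of the Stein solution and comparison through a Stein kernel\<close>

context stein_setup
begin

context
  fixes h :: "'a \<Rightarrow> real" and H :: "'a \<Rightarrow> 'a"
  assumes d: "\<And>x. (h has_derivative (\<lambda>v. H x \<bullet> v)) (at x)"
    and hB: "\<And>x. \<bar>h x\<bar> \<le> 1" and HB: "\<And>x. norm (H x) \<le> 1"
    and HL: "\<And>x y. norm (H x - H y) \<le> norm (x - y)"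
begin

text \<open>The function \<open>G\<close> of the overview, for general test functions.\<close>

definition stein_grad :: "'a \<Rightarrow> 'a" where
  "stein_grad x = (LINT p|\<kappa>. H (fst p *\<^sub>R x + snd p))"

lemma H_continuous: "continuous_on UNIV H"
  by (rule lipschitz_on_continuous_on[of 1]) (use HL in \<open>auto intro!: lipschitz_onI simp: dist_norm\<close>)

lemma H_measurable [measurable]: "H \<in> borel_measurable borel"
  by (rule borel_measurable_continuous_onI[OF H_continuous])

lemma h_measurable [measurable]: "h \<in> borel_measurable borel"
  using d has_derivative_continuous continuous_at_imp_continuous_on
  by (intro borel_measurable_continuous_onI) blast

lemma stein_grad_integrable: "integrable \<kappa> (\<lambda>p. H (fst p *\<^sub>R x + snd p))"
  by (rule \<kappa>.integrable_const_bound[of _ 1]) (use HB in auto)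

lemma norm_stein_grad: "norm (stein_grad x) \<le> 1"
proof -
  have "norm (stein_grad x) \<le> (LINT p|\<kappa>. norm (H (fst p *\<^sub>R x + snd p)))"
    unfolding stein_grad_def by (rule integral_norm_bound)
  also have "\<dots> \<le> (LINT p|\<kappa>. 1)"
    using stein_grad_integrable HB by (intro integral_mono) auto
  finally show ?thesis by (simp add: \<kappa>.prob_space[simplified])
qed

lemma integrable_fst_\<kappa>: "integrable \<kappa> fst" and integral_fst_\<kappa>: "(LINT p|\<kappa>. fst p) = 1/2"
proof -
  have 0: "AE p in \<kappa>. 0 \<le> fst p" using AE_\<kappa> by eventually_elim auto
  show "integrable \<kappa> fst"
  proof (rule integrableI_nonneg)
    show "(\<integral>\<^sup>+p. ennreal (fst p) \<partial>\<kappa>) < \<infinity>"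
      unfolding nn_integral_fst_\<kappa> infinity_ennreal_def by (rule ennreal_less_top)
  qed (use 0 in auto)
  show "(LINT p|\<kappa>. fst p) = 1/2"
  proof -
    have "(LINT p|\<kappa>. fst p) = enn2real (\<integral>\<^sup>+p. ennreal (fst p) \<partial>\<kappa>)"
      by (rule integral_eq_nn_integral) (use 0 in auto)
    then show ?thesis unfolding nn_integral_fst_\<kappa> by (simp only: enn2real_ennreal)
  qed
qed

lemma stein_grad_lipschitz: "norm (stein_grad (x + u) - stein_grad x) \<le> norm u / 2"
proof -
  have "stein_grad (x + u) - stein_grad x = (LINT p|\<kappa>. H (fst p *\<^sub>R (x + u) + snd p) - H (fst p *\<^sub>R x + snd p))"
    unfolding stein_grad_def using stein_grad_integrable by simp
  also have "norm \<dots> \<le> (LINT p|\<kappa>. norm (H (fst p *\<^sub>R (x + u) + snd p) - H (fst p *\<^sub>R x + snd p)))"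
    by (rule integral_norm_bound)
  also have "\<dots> \<le> (LINT p|\<kappa>. fst p * norm u)"
  proof (rule integral_mono_AE)
    show "AE p in \<kappa>. norm (H (fst p *\<^sub>R (x + u) + snd p) - H (fst p *\<^sub>R x + snd p)) \<le> fst p * norm u"
      using AE_\<kappa>
    proof eventually_elim
      case (elim p)
      then show ?case using HL[of "fst p *\<^sub>R (x + u) + snd p" "fst p *\<^sub>R x + snd p"]
        by (simp add: algebra_simps)
    qed
  qed (use integrable_fst_\<kappa> stein_grad_integrable in auto)
  also have "\<dots> = norm u / 2" by (simp add: integral_fst_\<kappa>)
  finally show ?thesis .
qed

lemma stein_grad_measurable [measurable]: "stein_grad \<in> borel_measurable borel"
  unfolding stein_grad_def[abs_def] by measurable

lemma stein_equation: "h x - (LINT z|M. h z) = x \<bullet> stein_grad x - (LINT u|\<nu>. u \<bullet> (stein_grad (x + u) - stein_grad x))"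
proof -
  have i: "(LINT p|\<kappa>. complex_of_real (H (fst p *\<^sub>R y + snd p) \<bullet> u)) = of_real (u \<bullet> stein_grad y)" for y u
    using integral_inner_left[of u \<kappa> "\<lambda>p. H (fst p *\<^sub>R y + snd p)"] stein_grad_integrable
    by (simp add: stein_grad_def inner_commute)
  have ii: "integrable \<kappa> (\<lambda>p. complex_of_real (H (fst p *\<^sub>R y + snd p) \<bullet> u))" for y u
    using stein_grad_integrable by (intro integrable_of_real) simp
  have "stein_pair (\<lambda>x. of_real (h x)) (\<lambda>x u. of_real (H x \<bullet> u))"
    by (rule stein_pair_bounded[where B=1]) (use d hB HB HL in auto)
  then have "complex_of_real (h x) - (LINT z|M. of_real (h z)) =
     of_real (x \<bullet> stein_grad x) - (LINT u|\<nu>. of_real (u \<bullet> stein_grad (x + u)) - of_real (u \<bullet> stein_grad x))"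
    unfolding stein_pair_def Bochner_Integration.integral_diff[OF ii ii] i by blast
  also have "(LINT u|\<nu>. complex_of_real (u \<bullet> stein_grad (x + u)) - of_real (u \<bullet> stein_grad x)) = of_real (LINT u|\<nu>. u \<bullet> (stein_grad (x + u) - stein_grad x))"
    by (simp only: integral_complex_of_real[symmetric] inner_diff_right of_real_diff)
  finally have "complex_of_real (h x - (LINT z|M. h z)) = of_real (x \<bullet> stein_grad x - (LINT u|\<nu>. u \<bullet> (stein_grad (x + u) - stein_grad x)))"
    by simp
  then show ?thesis by (simp only: of_real_eq_iff)
qed

text \<open>The increment of \<tau> splits as \<open>w\<close> plus \<open>u\<close>. In the Stein
  identity for \<open>stein_grad\<close>, the \<open>u\<close> part is exactly the integral term of
  \<open>stein_equation\<close>, so the difference of expectations is the integral of <g;w>. The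
  Lipschitz constant 1/2 of \<open>stein_grad\<close> and Cauchy-Schwarz on the product of
  \<open>N\<close> and \<nu> finish the estimate.\<close>

lemma stein_kernel_bound:
  assumes N: "borel_prob N" and cN: "centered N" and \<tau>: "stein_kernel \<nu> N \<tau>"
    and fin: "(\<integral>\<^sup>+y. (\<integral>\<^sup>+u. ennreal ((norm (\<tau> (y + u) - \<tau> y - u))\<^sup>2) \<partial>\<nu>) \<partial>N) < \<infinity>" (is "?I < _")
  shows "\<bar>(LINT z|M. h z) - (LINT y|N. h y)\<bar> \<le> 1 / 2 * (sqrt (LINT u|\<nu>. (norm u)\<^sup>2) * sqrt (enn2real ?I))"
proof -
  interpret N: prob_space N using N by (simp add: borel_prob_def)
  interpret P: pair_sigma_finite N \<nu> ..
  have sN [simp, measurable_cong]: "sets N = sets borel" using N by (simp add: borel_prob_def)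
  have [simp]: "space N = UNIV" by (simp add: sets_eq_imp_space_eq[OF sN])
  have [measurable]: "\<tau> \<in> borel_measurable borel" using \<tau> by (simp add: stein_kernel_def)
  let ?P = "N \<Otimes>\<^sub>M \<nu>"
  define w where "w q = \<tau> (fst q + snd q) - \<tau> (fst q) - snd q" for q :: "'a \<times> 'a"
  define g where "g q = stein_grad (fst q + snd q) - stein_grad (fst q)" for q :: "'a \<times> 'a"
  have [measurable]: "w \<in> borel_measurable (borel \<Otimes>\<^sub>M borel)" "g \<in> borel_measurable (borel \<Otimes>\<^sub>M borel)"
    unfolding w_def[abs_def] g_def[abs_def] by measurable
  have I: "(\<integral>\<^sup>+q. ennreal ((norm (w q))\<^sup>2) \<partial>?P) = ?I"
    by (subst \<nu>.nn_integral_fst[symmetric]) (auto simp: w_def)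
  have iw: "integrable ?P (\<lambda>q. (norm (w q))\<^sup>2)"
    by (rule integrableI_nonneg) (use fin I in auto)
  have Iw: "(LINT q|?P. (norm (w q))\<^sup>2) = enn2real ?I"
    by (subst integral_eq_nn_integral) (auto simp: I)
  have iu: "integrable ?P (\<lambda>q. (norm (snd q))\<^sup>2)"
    using Fubini_dominated(1)[OF N.sigma_finite_measure_axioms sigma_finite_\<nu>, of "\<lambda>y u. (norm u)\<^sup>2" "\<lambda>_. 1" "\<lambda>u. (norm u)\<^sup>2"] sq_\<nu>
    by (simp add: split_beta')
  have Iu: "(LINT q|?P. (norm (snd q))\<^sup>2) = (LINT u|\<nu>. (norm u)\<^sup>2)"
    using P.integral_fst'[OF iu] by (simp add: N.prob_space[simplified])
  have gb: "norm (g q) \<le> norm (snd q) / 2" for q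
    unfolding g_def by (rule stein_grad_lipschitz)
  have iuw: "integrable ?P (\<lambda>q. norm (snd q) * norm (w q))"
    and CS: "(LINT q|?P. norm (snd q) * norm (w q)) \<le> sqrt (LINT u|\<nu>. (norm u)\<^sup>2) * sqrt (enn2real ?I)"
    using Cauchy_Schwarz_integral[of "\<lambda>q. norm (snd q)" ?P "\<lambda>q. norm (w q)"] iu iw by (auto simp: Iu Iw)
  have gwb: "\<bar>g q \<bullet> w q\<bar> \<le> 1 / 2 * (norm (snd q) * norm (w q))" for q
    using Cauchy_Schwarz_ineq2[of "g q" "w q"] mult_right_mono[OF gb[of q] norm_ge_zero[of "w q"]] by simp
  have gub: "\<bar>snd q \<bullet> g q\<bar> \<le> (norm (snd q))\<^sup>2" for q
    using Cauchy_Schwarz_ineq2[of "snd q" "g q"] mult_left_mono[OF gb[of q] norm_ge_zero[of "snd q"]]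
      zero_le_power2[of "norm (snd q)"] by (simp add: power2_eq_square)
  have igw: "integrable ?P (\<lambda>q. g q \<bullet> w q)"
    by (rule Bochner_Integration.integrable_bound[OF integrable_mult_right[OF iuw, of "1/2"]])
      (use gwb in \<open>auto intro!: AE_I2 order_trans[OF _ abs_ge_self]\<close>)
  have igu: "integrable ?P (\<lambda>q. snd q \<bullet> g q)"
    by (rule Bochner_Integration.integrable_bound[OF iu]) (use gub in auto)
  let ?s = "\<lambda>q. g q \<bullet> w q + snd q \<bullet> g q"
  have isum: "integrable ?P ?s" by (intro Bochner_Integration.integrable_add igw igu)
  have s_eq: "?s (y, u) = (stein_grad (y + u) - stein_grad y) \<bullet> (\<tau> (y + u) - \<tau> y)" for y u
    by (simp add: g_def w_def inner_diff_right inner_diff_left inner_commute)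
  have iyG: "integrable N (\<lambda>y. y \<bullet> stein_grad y)"
  proof (rule Bochner_Integration.integrable_bound)
    show "integrable N (\<lambda>y. y)" using cN by (simp add: centered_def)
    show "AE y in N. norm (y \<bullet> stein_grad y) \<le> norm y"
    proof (intro AE_I2)
      fix y
      have "norm (y \<bullet> stein_grad y) \<le> norm y * norm (stein_grad y)" using Cauchy_Schwarz_ineq2[of y "stein_grad y"] by simp
      also have "\<dots> \<le> norm y * 1" by (intro mult_left_mono norm_stein_grad) simp
      finally show "norm (y \<bullet> stein_grad y) \<le> norm y" by simp
    qed
  qed measurable
  \<comment> \<open>This and \<open>iyG\<close> show that \<open>stein_grad\<close> is an admissible
    test function; \<open>fin\<close> supplies the square integrability of \<open>w\<close> behind
    it.\<close>
  have "(\<integral>\<^sup>+y. (\<integral>\<^sup>+u. ennreal \<bar>(stein_grad (y + u) - stein_grad y) \<bullet> (\<tau> (y + u) - \<tau> y)\<bar> \<partial>\<nu>) \<partial>N) = (\<integral>\<^sup>+q. ennreal \<bar>?s q\<bar> \<partial>?P)"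
    by (subst \<nu>.nn_integral_fst[symmetric]) (auto simp: s_eq[unfolded fst_conv snd_conv])
  also have "\<dots> < \<infinity>" using isum by (simp add: integrable_iff_bounded)
  finally have "(LINT y|N. y \<bullet> stein_grad y) = (LINT y|N. LINT u|\<nu>. (stein_grad (y + u) - stein_grad y) \<bullet> (\<tau> (y + u) - \<tau> y))"
    using \<tau> iyG by (simp add: stein_kernel_def)
  also have "\<dots> = (LINT q|?P. ?s q)"
    using P.integral_fst'[OF isum] by (simp only: s_eq)
  finally have k: "(LINT y|N. y \<bullet> stein_grad y) = (LINT q|?P. g q \<bullet> w q) + (LINT q|?P. snd q \<bullet> g q)"
    using igw igu by simp
  have j: "(LINT y|N. LINT u|\<nu>. u \<bullet> (stein_grad (y + u) - stein_grad y)) = (LINT q|?P. snd q \<bullet> g q)"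
    using P.integral_fst'[OF igu] by (simp add: g_def)
  have ij: "integrable N (\<lambda>y. LINT u|\<nu>. u \<bullet> (stein_grad (y + u) - stein_grad y))"
    using P.integrable_fst'[OF igu] by (simp add: g_def)
  have ih: "integrable N h" by (rule N.integrable_const_bound[of _ 1]) (use hB in auto)
  have "(LINT y|N. h y) - (LINT z|M. h z) = (LINT y|N. h y - (LINT z|M. h z))"
    using ih by (simp add: N.prob_space[simplified])
  \<comment> \<open>Averaging the Stein equation over \<open>N\<close>, the <u;g> integrals in
    \<open>k\<close> and \<open>j\<close> cancel.\<close>
  also have "\<dots> = (LINT q|?P. g q \<bullet> w q)"
    unfolding stein_equation using iyG ij k j by simp
  also have "\<bar>\<dots>\<bar> \<le> (LINT q|?P. 1 / 2 * (norm (snd q) * norm (w q)))"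
    by (rule order_trans[OF integral_abs_bound integral_mono])
      (use igw iuw gwb in auto)
  also have "\<dots> \<le> 1 / 2 * (sqrt (LINT u|\<nu>. (norm u)\<^sup>2) * sqrt (enn2real ?I))"
    using CS by simp
  finally show ?thesis by (simp add: abs_minus_commute)
qed

end

end

theorem theorem4p1:
  fixes MX MY \<nu> \<sigma> :: "'a::euclidean_space measure"
    and b :: 'a and k :: "'a \<Rightarrow> real \<Rightarrow> real"
  assumes "borel_prob MX" and "centered MX" and "nondegenerate MX"
    and "self_decomposable MX"
    and "infinitely_divisible_law MX b (\<lambda>_. 0) \<nu>"
    and "finite_second_moment MX"
    and "polar_decomposition \<nu> \<sigma> k"
    and "\<And>a b. 0 < a \<Longrightarrow> a < b \<Longrightarrow>
           esssup \<sigma> (\<lambda>x. SUP r\<in>{a<..<b}. ereal (k x r)) < \<infinity>"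
    and "borel_prob MY" and "centered MY" and "nondegenerate MY"
    and "finite_second_moment MY"
    and "\<exists>\<tau>. stein_kernel \<nu> MY \<tau>"
  shows "smooth_wasserstein 2 MX MY
           \<le> ennreal (real DIM('a) / 2)
             * ennreal_sqrt (\<integral>\<^sup>+u. ennreal ((norm u)\<^sup>2) \<partial>\<nu>)
             * stein_discrepancy \<nu> MY"
proof -
  obtain R where R: "\<And>s. 0 < s \<Longrightarrow> s < 1 \<Longrightarrow> borel_prob (R s) \<and>
      (\<forall>\<xi>. charfun (R s) \<xi> = charfun MX \<xi> / charfun MX (s *\<^sub>R \<xi>))"
    using assms(4) unfolding self_decomposable_def by metis
  have L: "levy_measure \<nu>" using assms(5) by (simp add: infinitely_divisible_law_def)
  have sets: "sets \<nu> = sets borel" using L by (simp add: levy_measure_def)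
  have sq: "integrable \<nu> (\<lambda>u. (norm u)\<^sup>2)" by (rule levy_second_moment[OF assms(5,6)])
  interpret stein_setup MX \<nu> R
  proof (rule stein_setup.intro)
    show "prob_space MX" "sets MX = sets borel" using assms(1) by (simp_all add: borel_prob_def)
    show "charfun MX (s *\<^sub>R \<xi>) = exp (levy_exponent \<nu> \<xi> s)" for s \<xi>
      by (rule charfun_levy_exponent[OF assms(5,6,2)])
    show "borel_prob (R s)" if "0 < s" "s < 1" for s using R[OF that] by blast
    show "charfun (R s) \<xi> = charfun MX \<xi> / charfun MX (s *\<^sub>R \<xi>)" if "0 < s" "s < 1" for s \<xi>
      using R[OF that] by blast
  qed (fact sets sq sigma_finite_levy[OF L sq])+
  define V where "V = (LINT u|\<nu>. (norm u)\<^sup>2)"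
  have V: "(\<integral>\<^sup>+u. ennreal ((norm u)\<^sup>2) \<partial>\<nu>) = ennreal V"
    unfolding V_def by (rule nn_integral_eq_integral[OF sq]) simp
  \<comment> \<open>Positivity permits division by \<open>c\<close> below. Since \<nu> is nonzero by
    the normalization in \<open>polar_decomposition\<close> and the origin is null, |u|^2 cannot
    vanish almost everywhere.\<close>
  have V0: "0 < V"
  proof (rule ccontr)
    assume "\<not> 0 < V"
    then have "(LINT u|\<nu>. (norm u)\<^sup>2) = 0" unfolding V_def by (simp add: order_antisym)
    then have "AE u in \<nu>. u = 0"
      using integral_nonneg_eq_0_iff_AE[OF sq] by simp
    then have "emeasure \<nu> (- {0}) = 0"
      by (subst AE_iff_measurable[symmetric, where P="\<lambda>u. u = 0"]) (auto simp: sets)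
    moreover have "emeasure \<nu> UNIV = emeasure \<nu> {0} + emeasure \<nu> (- {0})"
      by (subst plus_emeasure) (auto simp: sets)
    ultimately show False
      using L assms(7) by (simp add: levy_measure_def polar_decomposition_def)
  qed
  define c where "c = real DIM('a) / 2 * sqrt V"
  have c0: "0 < c" using V0 by (simp add: c_def DIM_positive)
  have c: "ennreal (real DIM('a) / 2) * ennreal_sqrt (\<integral>\<^sup>+u. ennreal ((norm u)\<^sup>2) \<partial>\<nu>) = ennreal c"
  proof -
    have "ennreal_sqrt (ennreal V) = ennreal (sqrt V)"
      using V0 by (simp add: ennreal_sqrt_def)
    then show ?thesis
      unfolding V c_def using V0 by (simp only: ennreal_mult')
  qed
  have "ennreal \<bar>(LINT x|MX. h x) - (LINT x|MY. h x)\<bar> \<le> ennreal c * stein_discrepancy \<nu> MY"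
    if h: "h \<in> wasserstein_test 2" for h
  proof -
    obtain H where H: "\<And>x. (h has_derivative (\<lambda>v. H x \<bullet> v)) (at x)" "\<And>x. \<bar>h x\<bar> \<le> 1" "\<And>x. norm (H x) \<le> 1"
      "\<And>x y. norm (H x - H y) \<le> norm (x - y)"
      using wasserstein_test_gradient[OF h] by blast
    let ?d = "\<bar>(LINT x|MX. h x) - (LINT x|MY. h x)\<bar>"
    \<comment> \<open>With the constant moved to the left, the bound can be checked kernel by kernel
      under the infimum; kernels of infinite cost satisfy it trivially.\<close>
    have "ennreal (?d / c) \<le> stein_discrepancy \<nu> MY"
      unfolding stein_discrepancy_def
    proof (rule INF_greatest)
      fix \<tau> assume "\<tau> \<in> {\<tau>. stein_kernel \<nu> MY \<tau>}"
      then have \<tau>: "stein_kernel \<nu> MY \<tau>" by simp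
      let ?I = "\<integral>\<^sup>+y. (\<integral>\<^sup>+u. ennreal ((norm (\<tau> (y + u) - \<tau> y - u))\<^sup>2) \<partial>\<nu>) \<partial>MY"
      show "ennreal (?d / c) \<le> ennreal_sqrt ?I"
      proof (cases "?I = \<infinity>")
        case False
        have "?d \<le> 1 / 2 * (sqrt V * sqrt (enn2real ?I))"
          unfolding V_def using False
          by (intro stein_kernel_bound[OF H assms(9,10) \<tau>]) (simp add: less_top)
        \<comment> \<open>The factor d enters only here, through d \<ge> 1.\<close>
        also have "\<dots> \<le> real DIM('a) / 2 * (sqrt V * sqrt (enn2real ?I))"
          using V0 by (intro mult_right_mono) (auto simp: Suc_le_eq)
        finally have "?d / c \<le> sqrt (enn2real ?I)"
          using c0 by (simp add: c_def divide_le_eq mult_ac)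
        then show ?thesis using False by (simp add: ennreal_sqrt_def ennreal_leI)
      qed (simp add: ennreal_sqrt_def)
    qed
    then have "ennreal c * ennreal (?d / c) \<le> ennreal c * stein_discrepancy \<nu> MY"
      by (intro mult_left_mono) auto
    then show ?thesis using c0 by (simp flip: ennreal_mult')
  qed
  then show ?thesis
    unfolding c smooth_wasserstein_def by (intro SUP_least)
qed

end
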